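(* Let $w,m$ be nonzero real numbers, let $\mathcal{U}_q=\mathcal{U}_q(G(1))$ be the one-dimensional quantum Galilei algebra with deformation parameter $iw$, and let $H_0$ be the $\mathcal{U}_q$-module $*$-algebra with linear basis $\{\chi_m^\ell\}_{\ell\in\mathbb{Z}}$ described in the context. Let $\nu_w:H_0\to\mathbb{C}$ be the linear functional $\nu_w(\chi_m^\ell)=\delta_{\ell,0}$. Let $\phi:\mathcal{U}_q\to H_0$ be defined by $$\phi[X]=\epsilon(X)+\sum_{n=1}^{\infty}c_n\,X(v^n)\,\chi_m^n,\qquad c_n=\Big(\frac{wm}{2}\Big)^n\,\frac{(2n-1)!!}{n!}.$$ Then $\nu_w$ is quasi-invariant with weight $\phi$, but it is not essentially invariant.
   Context: Quantum Galilei algebra: $\mathcal{U}_q(G(1))$ is the Hopf $*$-algebra over $\mathbb{C}$ generated by $K,K^{-1},B,M,T$ with $M$ central, $KK^{-1}=K^{-1}K=1$, and $$[K,T]=0,\qquad KBK^{-1}=B-iwM,\qquad [B,T]=i\,\frac{K-K^{-1}}{2w},$$ coproduct $\Delta M=M\otimes K+K^{-1}\otimes M$, $\Delta K=K\otimes K$, $\Delta T=T\otimes1+1\otimes T$, $\Delta B=B\otimes K+K^{-1}\otimes B$; antipode $S(M)=-M$, $S(K)=K^{-1}$, $S(T)=-T$, $S(B)=-B+iwM$; counit $\epsilon(M)=\epsilon(T)=\epsilon(B)=0$, $\epsilon(K)=1$; and involution making $K,B,M,T$ self-adjoint. Put $\tau(X)=S(X)^*$. With $I=K^{-1}M$ and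 $N=KB$, the elements $I^{\alpha}K^{\ell}T^{\gamma}N^{\delta}$ ($\alpha,\gamma,\delta\in\mathbb{N}$, $\ell\in\mathbb{Z}$) form a linear basis, and the numbers $X(v^n)$ (pairing of $X\in\mathcal{U}_q$ with the $n$-th power of the generator $v$ of the dual function algebra $\mathcal{F}_q(G(1))$) are given linearly by $$(I^{\alpha}K^{\ell}T^{\gamma}N^{\delta})(v^n)=i^n\,n!\;\delta_{\alpha,0}\,\delta_{\gamma,0}\,\delta_{\delta,n}.$$ The algebra $H_0$ (denoted $H_0^{\mathrm{irr}}$ in the source): the unital commutative $*$-algebra generated by self-adjoint $v_0,v_1$ with the relation $wm\,v_0v_1=v_1-v_0$. Put $\chi_m=1+wm\,v_1$; it is invertible with $\chi_m^{-1}=1-wm\,v_0$, it is self-adjoint, and $\{\chi_m^\ell\}_{\ell\in\mathbb{Z}}$ is a linear basis of $H_0$. $H_0$ is a left $\mathcal{U}_q$-module $*$-algebra (i.e. $X.(ab)=\sum_{(X)}(X_{(1)}.a)(X_{(2)}.b)$, $X.1=\epsilon(X)1$, $(X.a)^*=\tau(X).a^*$) via $$B.\chi_m^\ell=iwm\,\ell\,\chi_m^{\ell+1},\qquad K.f=f,\qquad T.f=M.f=0\quad(f\in H_0).$$ A linear functional $h$ on $H_0$ is real if $h(a^* )=\overline{h(a)}$. A real functional $h$ is quasi-invariant with weight $\phi$ if $\phi:\mathcal{U}_q\to H_0$ is a linear map with $\phi[XY]=\sum_{(X)}X_{(1)}.\phi[Y]\,\phi[X_{(2)}]$ (where $X.a\,b=(X.a)b$)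 and $\phi[1]=1$, and for all $X\in\mathcal{U}_q$, $a\in H_0$: $h(X.a)=\sum_{(X)}h\big(\phi[X_{(1)}^*]^*\,a\,\phi[S(X_{(2)})]\big)$. It is essentially invariant if it is quasi-invariant with a weight of the form $\phi[X]=X.\xi\;\xi^{-1}$ for some invertible $\xi\in H_0$. *)

theory Defs
  imports Complex_Main "HOL-Library.Poly_Mapping" "HOL-Library.Product_Plus"
    "HOL-Algebra.QuotRing" "HOL-Algebra.Module"
begin

section \<open>Complex algebras given by generators and relations\<close>

text \<open>Lists under concatenation are the free monoid, so \<^typ>\<open>'g list \<Rightarrow>\<^sub>0 complex\<close> with the
  convolution product of \<^theory>\<open>HOL-Library.Poly_Mapping\<close> is the free unital complex algebra on
  \<^typ>\<open>'g\<close>; likewise \<^typ>\<open>('g \<Rightarrow>\<^sub>0 nat) \<Rightarrow>\<^sub>0 complex\<close> is the free commutative one.\<close>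

instantiation list :: (type) monoid_add
begin
definition zero_list :: "'a list" where "zero_list = []"
definition plus_list :: "'a list \<Rightarrow> 'a list \<Rightarrow> 'a list" where "plus_list u v = u @ v"
instance by standard (simp_all add: zero_list_def plus_list_def)
end

definition const :: "complex \<Rightarrow> ('k::monoid_add \<Rightarrow>\<^sub>0 complex)" where
  "const c = Poly_Mapping.single 0 c"

definition gen :: "'g \<Rightarrow> ('g list \<Rightarrow>\<^sub>0 complex)" where
  "gen g = Poly_Mapping.single [g] 1"

definition cgen :: "'g \<Rightarrow> (('g \<Rightarrow>\<^sub>0 nat) \<Rightarrow>\<^sub>0 complex)" where
  "cgen g = Poly_Mapping.single (Poly_Mapping.single g 1) 1"

text \<open>The (anti-)multiplicative extension of a map on generators; \<open>s\<close> is the map applied to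
  scalars, so that \<open>s\<close> may also encode conjugate-linearity.\<close>

definition free_hom :: "(complex \<Rightarrow> 'b::semiring_1) \<Rightarrow> ('g \<Rightarrow> 'b) \<Rightarrow> ('g list \<Rightarrow>\<^sub>0 complex) \<Rightarrow> 'b" where
  "free_hom s f p =
     (\<Sum>u\<in>Poly_Mapping.keys p. s (Poly_Mapping.lookup p u) * prod_list (map f u))"

definition free_antihom :: "(complex \<Rightarrow> 'b::semiring_1) \<Rightarrow> ('g \<Rightarrow> 'b) \<Rightarrow> ('g list \<Rightarrow>\<^sub>0 complex) \<Rightarrow> 'b" where
  "free_antihom s f p =
     (\<Sum>u\<in>Poly_Mapping.keys p. s (Poly_Mapping.lookup p u) * prod_list (map f (rev u)))"

definition monoid_algebra :: "('k::monoid_add \<Rightarrow>\<^sub>0 complex) ring" where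
  "monoid_algebra = \<lparr>carrier = UNIV, monoid.mult = (*), one = 1, zero = 0, add = (+)\<rparr>"

definition cls :: "('k::monoid_add \<Rightarrow>\<^sub>0 complex) set \<Rightarrow> ('k \<Rightarrow>\<^sub>0 complex) \<Rightarrow> ('k \<Rightarrow>\<^sub>0 complex) set" where
  "cls R p = genideal monoid_algebra R +>\<^bsub>monoid_algebra\<^esub> p"

definition presented_algebra ::
    "('k::monoid_add \<Rightarrow>\<^sub>0 complex) set \<Rightarrow> (complex, ('k \<Rightarrow>\<^sub>0 complex) set) module" where
  "presented_algebra R =
    (let Q = monoid_algebra Quot genideal monoid_algebra R in
     \<lparr>carrier = carrier Q, monoid.mult = monoid.mult Q, one = one Q, zero = zero Q, add = add Q,
      smult = (\<lambda>c X. cls R (const c) \<otimes>\<^bsub>Q\<^esub> X)\<rparr>)"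

definition clinear ::
    "(complex, 'a, 'x) module_scheme \<Rightarrow> (complex, 'b, 'y) module_scheme \<Rightarrow> ('a \<Rightarrow> 'b) \<Rightarrow> bool" where
  "clinear A B f \<longleftrightarrow> f \<in> carrier A \<rightarrow> carrier B \<and>
     (\<forall>x\<in>carrier A. \<forall>y\<in>carrier A. f (x \<oplus>\<^bsub>A\<^esub> y) = f x \<oplus>\<^bsub>B\<^esub> f y) \<and>
     (\<forall>c. \<forall>x\<in>carrier A. f (c \<odot>\<^bsub>A\<^esub> x) = c \<odot>\<^bsub>B\<^esub> f x)"

definition linear_functional :: "(complex, 'a, 'x) module_scheme \<Rightarrow> ('a \<Rightarrow> complex) \<Rightarrow> bool" where
  "linear_functional A f \<longleftrightarrow>
     (\<forall>x\<in>carrier A. \<forall>y\<in>carrier A. f (x \<oplus>\<^bsub>A\<^esub> y) = f x + f y) \<and>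
     (\<forall>c. \<forall>x\<in>carrier A. f (c \<odot>\<^bsub>A\<^esub> x) = c * f x)"


section \<open>The quantum Galilei algebra\<close>

datatype galilei_gen = Gen_K | Gen_Kinv | Gen_B | Gen_M | Gen_T

type_synonym galilei_free = "galilei_gen list \<Rightarrow>\<^sub>0 complex"

definition uq_relators :: "real \<Rightarrow> galilei_free set" where
  "uq_relators w =
    (let K = gen Gen_K; K' = gen Gen_Kinv; B = gen Gen_B; M = gen Gen_M; T = gen Gen_T in
     {M * gen g - gen g * M | g. True} \<union>
     {K * K' - 1, K' * K - 1, K * T - T * K,
      K * B * K' - (B - const (\<i> * of_real w) * M),
      B * T - T * B - const (\<i> / (2 * of_real w)) * (K - K')})"

abbreviation Uq :: "real \<Rightarrow> (complex, galilei_free set) module" where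
  "Uq w \<equiv> presented_algebra (uq_relators w)"

definition uq_K :: "real \<Rightarrow> galilei_free set" where "uq_K w = cls (uq_relators w) (gen Gen_K)"
definition uq_B :: "real \<Rightarrow> galilei_free set" where "uq_B w = cls (uq_relators w) (gen Gen_B)"
definition uq_M :: "real \<Rightarrow> galilei_free set" where "uq_M w = cls (uq_relators w) (gen Gen_M)"
definition uq_T :: "real \<Rightarrow> galilei_free set" where "uq_T w = cls (uq_relators w) (gen Gen_T)"

definition uq_I :: "real \<Rightarrow> galilei_free set" where
  "uq_I w = inv\<^bsub>Uq w\<^esub> uq_K w \<otimes>\<^bsub>Uq w\<^esub> uq_M w"

definition uq_N :: "real \<Rightarrow> galilei_free set" where
  "uq_N w = uq_K w \<otimes>\<^bsub>Uq w\<^esub> uq_B w"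

subsection \<open>The tensor square\<close>

text \<open>For the free algebra \<open>F\<close>, the algebra \<open>F \<otimes> F\<close> has the pairs of words as a basis, multiplied
  componentwise. With \<open>J\<close> the ideal of relations, \<open>F/J \<otimes> F/J\<close> is the quotient of \<open>F \<otimes> F\<close> by
  \<open>J \<otimes> F + F \<otimes> J\<close>, which is the ideal generated by the \<open>r \<otimes> 1\<close> and \<open>1 \<otimes> r\<close>.\<close>

definition free_tensor :: "galilei_free \<Rightarrow> galilei_free \<Rightarrow> (galilei_gen list \<times> galilei_gen list \<Rightarrow>\<^sub>0 complex)" where
  "free_tensor p q = (\<Sum>u\<in>Poly_Mapping.keys p. \<Sum>v\<in>Poly_Mapping.keys q.
     Poly_Mapping.single (u, v) (Poly_Mapping.lookup p u * Poly_Mapping.lookup q v))"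

definition uq2_relators :: "real \<Rightarrow> (galilei_gen list \<times> galilei_gen list \<Rightarrow>\<^sub>0 complex) set" where
  "uq2_relators w = (\<Union>r\<in>uq_relators w. {free_tensor r 1, free_tensor 1 r})"

abbreviation Uq2 :: "real \<Rightarrow> (complex, (galilei_gen list \<times> galilei_gen list \<Rightarrow>\<^sub>0 complex) set) module" where
  "Uq2 w \<equiv> presented_algebra (uq2_relators w)"

definition uq_tensor ::
    "real \<Rightarrow> galilei_free set \<Rightarrow> galilei_free set \<Rightarrow> (galilei_gen list \<times> galilei_gen list \<Rightarrow>\<^sub>0 complex) set" where
  "uq_tensor w X Y = (\<Union>x\<in>X. \<Union>y\<in>Y. cls (uq2_relators w) (free_tensor x y))"

subsection \<open>Hopf star-structure\<close>

text \<open>Each structure map is defined on the free algebra and descends to cosets.\<close>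

fun coprod_gen :: "galilei_gen \<Rightarrow> (galilei_gen list \<times> galilei_gen list \<Rightarrow>\<^sub>0 complex)" where
  "coprod_gen Gen_K = free_tensor (gen Gen_K) (gen Gen_K)"
| "coprod_gen Gen_Kinv = free_tensor (gen Gen_Kinv) (gen Gen_Kinv)"
| "coprod_gen Gen_B = free_tensor (gen Gen_B) (gen Gen_K) + free_tensor (gen Gen_Kinv) (gen Gen_B)"
| "coprod_gen Gen_M = free_tensor (gen Gen_M) (gen Gen_K) + free_tensor (gen Gen_Kinv) (gen Gen_M)"
| "coprod_gen Gen_T = free_tensor (gen Gen_T) 1 + free_tensor 1 (gen Gen_T)"

fun counit_gen :: "galilei_gen \<Rightarrow> complex" where
  "counit_gen Gen_K = 1"
| "counit_gen Gen_Kinv = 1"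
| "counit_gen Gen_B = 0"
| "counit_gen Gen_M = 0"
| "counit_gen Gen_T = 0"

fun antipode_gen :: "real \<Rightarrow> galilei_gen \<Rightarrow> galilei_free" where
  "antipode_gen w Gen_K = gen Gen_Kinv"
| "antipode_gen w Gen_Kinv = gen Gen_K"
| "antipode_gen w Gen_B = - gen Gen_B + const (\<i> * of_real w) * gen Gen_M"
| "antipode_gen w Gen_M = - gen Gen_M"
| "antipode_gen w Gen_T = - gen Gen_T"

definition uq_coprod ::
    "real \<Rightarrow> galilei_free set \<Rightarrow> (galilei_gen list \<times> galilei_gen list \<Rightarrow>\<^sub>0 complex) set" where
  "uq_coprod w X = (\<Union>x\<in>X. cls (uq2_relators w) (free_hom const coprod_gen x))"

definition uq_counit :: "galilei_free set \<Rightarrow> complex" where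
  "uq_counit X = the_elem (free_hom id counit_gen ` X)"

definition uq_antipode :: "real \<Rightarrow> galilei_free set \<Rightarrow> galilei_free set" where
  "uq_antipode w X = (\<Union>x\<in>X. cls (uq_relators w) (free_antihom const (antipode_gen w) x))"

definition uq_star :: "real \<Rightarrow> galilei_free set \<Rightarrow> galilei_free set" where
  "uq_star w X = (\<Union>x\<in>X. cls (uq_relators w) (free_antihom (\<lambda>c. const (cnj c)) gen x))"

definition uq_tau :: "real \<Rightarrow> galilei_free set \<Rightarrow> galilei_free set" where
  "uq_tau w X = uq_star w (uq_antipode w X)"

text \<open>\<open>sweedler w X n P Q\<close> says that \<open>\<Delta> X = P\<^sub>0 \<otimes> Q\<^sub>0 + \<dots> + P\<^bsub>n-1\<^esub> \<otimes> Q\<^bsub>n-1\<^esub>\<close>. An identity in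
  Sweedler notation is required below for all such representations of \<open>\<Delta> X\<close>; the expressions
  involved are bilinear in \<open>(X\<^sub>1, X\<^sub>2)\<close>, so the choice of representation is immaterial.\<close>

definition sweedler ::
    "real \<Rightarrow> galilei_free set \<Rightarrow> nat \<Rightarrow> (nat \<Rightarrow> galilei_free set) \<Rightarrow> (nat \<Rightarrow> galilei_free set) \<Rightarrow> bool" where
  "sweedler w X n P Q \<longleftrightarrow>
     (\<forall>i<n. P i \<in> carrier (Uq w) \<and> Q i \<in> carrier (Uq w)) \<and>
     uq_coprod w X = (\<Oplus>\<^bsub>Uq2 w\<^esub>i\<in>{..<n}. uq_tensor w (P i) (Q i))"

subsection \<open>Pairing with the powers of the generator v\<close>

text \<open>\<open>pairing n X\<close> stands for \<open>X(v\<^sup>n)\<close>.\<close>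

definition is_v_pairing :: "real \<Rightarrow> (nat \<Rightarrow> galilei_free set \<Rightarrow> complex) \<Rightarrow> bool" where
  "is_v_pairing w pairing \<longleftrightarrow> (\<forall>n. linear_functional (Uq w) (pairing n) \<and>
     (\<forall>(\<alpha>::nat) (l::int) (\<gamma>::nat) (\<delta>::nat).
        pairing n (uq_I w [^]\<^bsub>Uq w\<^esub> \<alpha> \<otimes>\<^bsub>Uq w\<^esub> uq_K w [^]\<^bsub>Uq w\<^esub> l \<otimes>\<^bsub>Uq w\<^esub> uq_T w [^]\<^bsub>Uq w\<^esub> \<gamma>
                     \<otimes>\<^bsub>Uq w\<^esub> uq_N w [^]\<^bsub>Uq w\<^esub> \<delta>) =
        (if \<alpha> = 0 \<and> \<gamma> = 0 \<and> \<delta> = n then \<i> ^ n * fact n else 0)))"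


section \<open>The algebra H0\<close>

datatype h0_gen = Gen_v0 | Gen_v1

type_synonym h0_free = "(h0_gen \<Rightarrow>\<^sub>0 nat) \<Rightarrow>\<^sub>0 complex"

definition h0_relators :: "real \<Rightarrow> real \<Rightarrow> h0_free set" where
  "h0_relators w m =
     {const (of_real (w * m)) * cgen Gen_v0 * cgen Gen_v1 - (cgen Gen_v1 - cgen Gen_v0)}"

abbreviation H0 :: "real \<Rightarrow> real \<Rightarrow> (complex, h0_free set) module" where
  "H0 w m \<equiv> presented_algebra (h0_relators w m)"

definition h0_v1 :: "real \<Rightarrow> real \<Rightarrow> h0_free set" where
  "h0_v1 w m = cls (h0_relators w m) (cgen Gen_v1)"

definition chi :: "real \<Rightarrow> real \<Rightarrow> h0_free set" where
  "chi w m = \<one>\<^bsub>H0 w m\<^esub> \<oplus>\<^bsub>H0 w m\<^esub> complex_of_real (w * m) \<odot>\<^bsub>H0 w m\<^esub> h0_v1 w m"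

text \<open>The involution fixes both generators, hence it conjugates coefficients.\<close>

definition h0_star :: "real \<Rightarrow> real \<Rightarrow> h0_free set \<Rightarrow> h0_free set" where
  "h0_star w m a = (\<Union>p\<in>a. cls (h0_relators w m) (Poly_Mapping.map cnj p))"

definition module_star_algebra ::
    "real \<Rightarrow> real \<Rightarrow> (galilei_free set \<Rightarrow> h0_free set \<Rightarrow> h0_free set) \<Rightarrow> bool" where
  "module_star_algebra w m act \<longleftrightarrow>
     (\<forall>X\<in>carrier (Uq w). clinear (H0 w m) (H0 w m) (act X)) \<and>
     (\<forall>a\<in>carrier (H0 w m). clinear (Uq w) (H0 w m) (\<lambda>X. act X a)) \<and>
     (\<forall>X\<in>carrier (Uq w). \<forall>Y\<in>carrier (Uq w). \<forall>a\<in>carrier (H0 w m).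
        act (X \<otimes>\<^bsub>Uq w\<^esub> Y) a = act X (act Y a)) \<and>
     (\<forall>a\<in>carrier (H0 w m). act \<one>\<^bsub>Uq w\<^esub> a = a) \<and>
     (\<forall>X\<in>carrier (Uq w). \<forall>a\<in>carrier (H0 w m). \<forall>b\<in>carrier (H0 w m).
        \<forall>n P Q. sweedler w X n P Q \<longrightarrow>
          act X (a \<otimes>\<^bsub>H0 w m\<^esub> b) = (\<Oplus>\<^bsub>H0 w m\<^esub>i\<in>{..<n}. act (P i) a \<otimes>\<^bsub>H0 w m\<^esub> act (Q i) b)) \<and>
     (\<forall>X\<in>carrier (Uq w). act X \<one>\<^bsub>H0 w m\<^esub> = uq_counit X \<odot>\<^bsub>H0 w m\<^esub> \<one>\<^bsub>H0 w m\<^esub>) \<and>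
     (\<forall>X\<in>carrier (Uq w). \<forall>a\<in>carrier (H0 w m).
        h0_star w m (act X a) = act (uq_tau w X) (h0_star w m a))"


section \<open>Quasi-invariance\<close>

definition real_functional :: "real \<Rightarrow> real \<Rightarrow> (h0_free set \<Rightarrow> complex) \<Rightarrow> bool" where
  "real_functional w m h \<longleftrightarrow> linear_functional (H0 w m) h \<and>
     (\<forall>a\<in>carrier (H0 w m). h (h0_star w m a) = cnj (h a))"

definition is_weight ::
    "real \<Rightarrow> real \<Rightarrow> (galilei_free set \<Rightarrow> h0_free set \<Rightarrow> h0_free set) \<Rightarrow>
     (galilei_free set \<Rightarrow> h0_free set) \<Rightarrow> bool" where
  "is_weight w m act \<phi> \<longleftrightarrow>
     clinear (Uq w) (H0 w m) \<phi> \<and>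
     (\<forall>X\<in>carrier (Uq w). \<forall>Y\<in>carrier (Uq w). \<forall>n P Q. sweedler w X n P Q \<longrightarrow>
        \<phi> (X \<otimes>\<^bsub>Uq w\<^esub> Y) = (\<Oplus>\<^bsub>H0 w m\<^esub>i\<in>{..<n}. act (P i) (\<phi> Y) \<otimes>\<^bsub>H0 w m\<^esub> \<phi> (Q i))) \<and>
     \<phi> \<one>\<^bsub>Uq w\<^esub> = \<one>\<^bsub>H0 w m\<^esub>"

definition quasi_invariant ::
    "real \<Rightarrow> real \<Rightarrow> (galilei_free set \<Rightarrow> h0_free set \<Rightarrow> h0_free set) \<Rightarrow>
     (h0_free set \<Rightarrow> complex) \<Rightarrow> (galilei_free set \<Rightarrow> h0_free set) \<Rightarrow> bool" where
  "quasi_invariant w m act h \<phi> \<longleftrightarrow>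
     real_functional w m h \<and> is_weight w m act \<phi> \<and>
     (\<forall>X\<in>carrier (Uq w). \<forall>a\<in>carrier (H0 w m). \<forall>n P Q. sweedler w X n P Q \<longrightarrow>
        h (act X a) =
        (\<Sum>i<n. h (h0_star w m (\<phi> (uq_star w (P i))) \<otimes>\<^bsub>H0 w m\<^esub> a
                    \<otimes>\<^bsub>H0 w m\<^esub> \<phi> (uq_antipode w (Q i)))))"

definition essentially_invariant ::
    "real \<Rightarrow> real \<Rightarrow> (galilei_free set \<Rightarrow> h0_free set \<Rightarrow> h0_free set) \<Rightarrow>
     (h0_free set \<Rightarrow> complex) \<Rightarrow> bool" where
  "essentially_invariant w m act h \<longleftrightarrow>
     (\<exists>\<xi>\<in>Units (H0 w m). quasi_invariant w m act h (\<lambda>X. act X \<xi> \<otimes>\<^bsub>H0 w m\<^esub> inv\<^bsub>H0 w m\<^esub> \<xi>))"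

end

theory Submission
  imports Defs "HOL-Computational_Algebra.Polynomial"
begin

text \<open>
  Sending \<open>K\<close> to \<open>1\<close>, \<open>M\<close> and \<open>T\<close> to \<open>0\<close> and \<open>B\<close> to \<open>z\<close> defines a Hopf algebra homomorphism from
  \<open>U\<^sub>q\<close> onto \<open>\<complex>[z]\<close> with \<open>z\<close> primitive, the symbol. Everything in the statement factors through
  it: \<open>X\<close> acts on the Laurent polynomials in \<open>\<chi>\<close> as \<open>p(D)\<close>, where \<open>p\<close> is the symbol of \<open>X\<close> and
  \<open>D = iwm \<chi>\<^sup>2 d/d\<chi>\<close>, and the pairing with \<open>v\<^sup>n\<close> is \<open>i\<^sup>n n!\<close> times the coefficient of \<open>z\<^sup>n\<close> in \<open>p\<close>
  (only the spanning half of the Poincare-Birkhoff-Witt theorem is needed for this).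

  Formally \<open>\<phi>[X] = X.\<xi> \<xi>\<^sup>-\<^sup>1\<close> for \<open>\<xi> = \<chi>\<^bsup>1/2\<^esup>\<close>, that is \<open>\<phi>[X] = p(D') 1\<close> with \<open>D' = D + (iwm/2) \<chi>\<close>.
  If operators satisfy \<open>G(ab) = E(a) b + a F(b)\<close>, then \<open>\<Sum> p\<^sub>1(E) a \<cdot> p\<^sub>2(F) b = p(G)(ab)\<close> where
  \<open>p\<^sub>1, p\<^sub>2\<close> are the symbols of the Sweedler components. The weight property is the case
  \<open>E = D\<close>, \<open>F = G = D'\<close>; quasi-invariance is the case \<open>E = F = - D'\<close>, \<open>G = - D - iwm \<chi>\<close>, since
  this \<open>G\<close> is the transpose of \<open>D\<close> under \<open>\<nu>\<close>.

  For the negative part, evaluating quasi-invariance at \<open>X = B\<close>, \<open>a = \<chi>\<^sup>-\<^sup>1\<close> gives \<open>r - r\<^sup>* = iwm\<close> for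
  the coefficient \<open>r\<close> of \<open>\<chi>\<close> in \<open>D\<xi> \<xi>\<^sup>-\<^sup>1\<close>, whereas comparing top degrees in \<open>\<xi> \<xi>\<^sup>-\<^sup>1 = 1\<close> shows
  that \<open>r\<close> is an integer multiple of \<open>iwm\<close>.
\<close>

section \<open>Quotients of monoid algebras\<close>

lemma monoid_algebra_simps [simp]:
  "carrier monoid_algebra = UNIV" "monoid.mult monoid_algebra = (*)" "one monoid_algebra = 1"
  "zero monoid_algebra = 0" "add monoid_algebra = (+)"
  by (simp_all add: monoid_algebra_def)

lemma ring_monoid_algebra: "ring (monoid_algebra :: ('k::monoid_add \<Rightarrow>\<^sub>0 complex) ring)"
proof (rule ringI)
  show "abelian_group (monoid_algebra :: ('k \<Rightarrow>\<^sub>0 complex) ring)"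
  proof (rule abelian_groupI)
    fix x :: "'k \<Rightarrow>\<^sub>0 complex"
    show "\<exists>y\<in>carrier monoid_algebra. y \<oplus>\<^bsub>monoid_algebra\<^esub> x = \<zero>\<^bsub>monoid_algebra\<^esub>"
      by (rule bexI [of _ "- x"]) auto
  qed (auto simp: algebra_simps)
  show "Group.monoid (monoid_algebra :: ('k \<Rightarrow>\<^sub>0 complex) ring)"
    by (rule monoidI) (auto simp: algebra_simps)
qed (auto simp: algebra_simps)

lemma a_minus_monoid_algebra [simp]:
  "a_inv monoid_algebra x = - (x :: 'k::monoid_add \<Rightarrow>\<^sub>0 complex)"
proof -
  interpret ring "monoid_algebra :: ('k \<Rightarrow>\<^sub>0 complex) ring" by (rule ring_monoid_algebra)
  show ?thesis by (rule minus_equality) auto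
qed

section \<open>Ideals generated by relators\<close>

lemma ideal_genideal: "ideal (genideal monoid_algebra R) (monoid_algebra :: ('k::monoid_add \<Rightarrow>\<^sub>0 complex) ring)"
  using ring.genideal_ideal [OF ring_monoid_algebra] by simp

context
  fixes R :: "('k::monoid_add \<Rightarrow>\<^sub>0 complex) set"
begin

interpretation ideal "genideal monoid_algebra R" "monoid_algebra :: ('k \<Rightarrow>\<^sub>0 complex) ring"
  by (rule ideal_genideal)

lemma genideal_0: "0 \<in> genideal monoid_algebra R"
  using additive_subgroup.zero_closed [OF is_additive_subgroup] by simp

lemma genideal_add:
  "x \<in> genideal monoid_algebra R \<Longrightarrow> y \<in> genideal monoid_algebra R \<Longrightarrow> x + y \<in> genideal monoid_algebra R"
  using additive_subgroup.a_closed [OF is_additive_subgroup] by simp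

lemma genideal_mult_left: "x \<in> genideal monoid_algebra R \<Longrightarrow> a * x \<in> genideal monoid_algebra R"
  using I_l_closed by simp

lemma genideal_mult_right: "x \<in> genideal monoid_algebra R \<Longrightarrow> x * a \<in> genideal monoid_algebra R"
  using I_r_closed by simp

lemma genideal_uminus: "x \<in> genideal monoid_algebra R \<Longrightarrow> - x \<in> genideal monoid_algebra R"
  using genideal_mult_left [of x "-1"] by simp

lemma genideal_diff:
  "x \<in> genideal monoid_algebra R \<Longrightarrow> y \<in> genideal monoid_algebra R \<Longrightarrow> x - y \<in> genideal monoid_algebra R"
  using genideal_add [of x "-y"] genideal_uminus by simp

lemma genideal_relator: "r \<in> R \<Longrightarrow> r \<in> genideal monoid_algebra R"
  using ring.genideal_self [OF ring_monoid_algebra, of R] by auto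

text \<open>The elements satisfying \<open>P\<close> form an ideal containing \<open>R\<close>,
  hence contain the smallest such ideal; negation is multiplication by -1. This reduces claims about
  all consequences of the relations to the relators themselves.\<close>

lemma genideal_induct [consumes 1, case_names relator zero add mult_left mult_right]:
  assumes "x \<in> genideal monoid_algebra R"
    and relator: "\<And>r. r \<in> R \<Longrightarrow> P r" and zero: "P 0"
    and add: "\<And>x y. P x \<Longrightarrow> P y \<Longrightarrow> P (x + y)"
    and mult_left: "\<And>a x. P x \<Longrightarrow> P (a * x)" and mult_right: "\<And>a x. P x \<Longrightarrow> P (x * a)"
  shows "P x"
proof -
  have uminus: "P (- x)" if "P x" for x using mult_left [OF that, of "-1"] by simp
  have "ideal (Collect P) (monoid_algebra :: ('k \<Rightarrow>\<^sub>0 complex) ring)"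
  proof (rule idealI [OF ring_monoid_algebra])
    show "subgroup (Collect P) (add_monoid (monoid_algebra :: ('k \<Rightarrow>\<^sub>0 complex) ring))"
    proof (rule subgroup.intro)
      fix x :: "'k \<Rightarrow>\<^sub>0 complex"
      assume "x \<in> Collect P"
      then show "inv\<^bsub>add_monoid monoid_algebra\<^esub> x \<in> Collect P"
        using uminus a_minus_monoid_algebra [of x] by (simp add: a_inv_def del: a_minus_monoid_algebra)
    qed (auto simp: zero add)
  qed (auto simp: mult_left mult_right)
  moreover have "R \<subseteq> Collect P" using relator by auto
  ultimately have "genideal monoid_algebra R \<subseteq> Collect P"
    by (rule ring.genideal_minimal [OF ring_monoid_algebra])
  with assms(1) show ?thesis by auto
qed

section \<open>Cosets as congruence classes\<close>

lemma mem_cls_iff: "p \<in> cls R q \<longleftrightarrow> p - q \<in> genideal monoid_algebra R"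
proof
  assume "p - q \<in> genideal monoid_algebra R"
  then show "p \<in> cls R q" by (auto simp: cls_def a_r_coset_def r_coset_def intro!: bexI [of _ "p - q"])
qed (auto simp: cls_def a_r_coset_def r_coset_def)

lemma cls_self [simp]: "p \<in> cls R p"
  by (simp add: mem_cls_iff genideal_0)

lemma cls_eq_iff: "cls R p = cls R q \<longleftrightarrow> p - q \<in> genideal monoid_algebra R"
proof
  assume "cls R p = cls R q"
  then show "p - q \<in> genideal monoid_algebra R" by (metis cls_self mem_cls_iff)
next
  assume *: "p - q \<in> genideal monoid_algebra R"
  have "x - p \<in> genideal monoid_algebra R \<longleftrightarrow> x - q \<in> genideal monoid_algebra R" for x
    using genideal_add [of "x - p" "p - q"] genideal_diff [of "x - q" "p - q"] * by auto
  then show "cls R p = cls R q" by (auto simp: mem_cls_iff)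
qed

lemma cls_eqI: "p \<in> cls R q \<Longrightarrow> cls R p = cls R q"
  by (simp add: cls_eq_iff mem_cls_iff)

lemma cls_add_cong: "cls R a = cls R a' \<Longrightarrow> cls R b = cls R b' \<Longrightarrow> cls R (a + b) = cls R (a' + b')"
  unfolding cls_eq_iff by (drule (1) genideal_add) (simp add: algebra_simps)

lemma cls_diff_cong: "cls R a = cls R a' \<Longrightarrow> cls R b = cls R b' \<Longrightarrow> cls R (a - b) = cls R (a' - b')"
  unfolding cls_eq_iff by (drule (1) genideal_diff) (simp add: algebra_simps)

lemma cls_mult_cong:
  assumes "cls R a = cls R a'" "cls R b = cls R b'"
  shows "cls R (a * b) = cls R (a' * b')"
proof -
  have "a * b - a' * b' = (a - a') * b + a' * (b - b')" by (simp add: algebra_simps)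
  then show ?thesis
    using assms unfolding cls_eq_iff by (metis genideal_add genideal_mult_left genideal_mult_right)
qed

section \<open>Ring operations, powers and inverses in a presented algebra\<close>

lemma presented_algebra_simps [simp]:
  "carrier (presented_algebra R) = range (cls R)"
  "cls R p \<otimes>\<^bsub>presented_algebra R\<^esub> cls R q = cls R (p * q)"
  "\<one>\<^bsub>presented_algebra R\<^esub> = cls R 1"
  "cls R p \<oplus>\<^bsub>presented_algebra R\<^esub> cls R q = cls R (p + q)"
  "\<zero>\<^bsub>presented_algebra R\<^esub> = cls R 0"
  "c \<odot>\<^bsub>presented_algebra R\<^esub> cls R p = cls R (const c * p)"
proof -
  show "carrier (presented_algebra R) = range (cls R)"
    by (auto simp: presented_algebra_def Let_def FactRing_def A_RCOSETS_def' cls_def)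
  show m: "cls R p \<otimes>\<^bsub>presented_algebra R\<^esub> cls R q = cls R (p * q)" for p q
    using rcoset_mult_add [of p q] by (simp add: presented_algebra_def Let_def FactRing_def cls_def)
  show "\<one>\<^bsub>presented_algebra R\<^esub> = cls R 1"
    by (simp add: presented_algebra_def Let_def FactRing_def cls_def)
  show "cls R p \<oplus>\<^bsub>presented_algebra R\<^esub> cls R q = cls R (p + q)"
    using a_rcos_sum [of p q] by (simp add: presented_algebra_def Let_def FactRing_def cls_def)
  have "genideal monoid_algebra R = cls R 0" by (auto simp: mem_cls_iff)
  then show "\<zero>\<^bsub>presented_algebra R\<^esub> = cls R 0"
    by (simp add: presented_algebra_def Let_def FactRing_def)
  show "c \<odot>\<^bsub>presented_algebra R\<^esub> cls R p = cls R (const c * p)"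
    using m [of "const c" p] by (simp add: presented_algebra_def Let_def)
qed

lemma ring_presented_algebra: "ring (presented_algebra R)"
proof (rule ringI)
  show "abelian_group (presented_algebra R)"
  proof (rule abelian_groupI)
    fix X assume "X \<in> carrier (presented_algebra R)"
    then obtain x where "X = cls R x" by auto
    then show "\<exists>Y\<in>carrier (presented_algebra R). Y \<oplus>\<^bsub>presented_algebra R\<^esub> X = \<zero>\<^bsub>presented_algebra R\<^esub>"
      by (intro bexI [of _ "cls R (- x)"]) auto
  qed (auto simp: algebra_simps)
  show "Group.monoid (presented_algebra R)"
    by (rule monoidI) (auto simp: algebra_simps)
qed (auto simp: algebra_simps)

lemma cls_finsum:
  assumes "finite A"
  shows "(\<Oplus>\<^bsub>presented_algebra R\<^esub>i\<in>A. cls R (f i)) = cls R (sum f A)"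
proof -
  interpret Q: ring "presented_algebra R" by (rule ring_presented_algebra)
  show ?thesis using assms by (induct A) (simp_all add: Q.finsum_insert)
qed

lemma cls_pow: "cls R p [^]\<^bsub>presented_algebra R\<^esub> n = cls R (p ^ n)" for n :: nat
proof -
  interpret Q: ring "presented_algebra R" by (rule ring_presented_algebra)
  show ?thesis by (induct n) (simp_all add: power_commutes)
qed

lemma cls_inv:
  assumes "cls R (p * q) = cls R 1" "cls R (q * p) = cls R 1"
  shows "inv\<^bsub>presented_algebra R\<^esub> cls R p = cls R q"
proof -
  interpret Q: ring "presented_algebra R" by (rule ring_presented_algebra)
  show ?thesis by (rule Q.inv_char) (simp_all add: assms)
qed

text \<open>The product is cancelled from the middle outwards, since the algebra may be
  noncommutative.\<close>

lemma cls_power_inverse: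
  assumes "cls R (p * q) = cls R 1"
  shows "cls R (p ^ n * q ^ n) = cls R 1"
proof (induct n)
  case (Suc n)
  have "cls R (p ^ Suc n * q ^ Suc n) = cls R (p ^ n * ((p * q) * q ^ n))"
    by (simp only: power_Suc2 [of p] power_Suc [of q] mult.assoc)
  also have "\<dots> = cls R (p ^ n * (1 * q ^ n))" by (intro cls_mult_cong assms refl)
  finally show ?case using Suc by simp
qed simp

lemma cls_int_pow:
  fixes l :: int
  assumes "cls R (p * q) = cls R 1" "cls R (q * p) = cls R 1"
  shows "cls R p [^]\<^bsub>presented_algebra R\<^esub> l = cls R (if l < 0 then q ^ nat (- l) else p ^ nat l)"
  by (simp add: int_pow_def2 cls_pow cls_inv [OF cls_power_inverse cls_power_inverse] assms)

end

text \<open>The structure maps are unions of cosets over all representatives. An additive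
  \<open>f\<close> sending one ideal into the other makes all these cosets equal, so the union
  collapses to the value at any one representative.\<close>

lemma Union_cls_image:
  assumes "\<And>x y. f (x - y) = f x - f y"
    and "\<And>r. r \<in> genideal monoid_algebra R \<Longrightarrow> f r \<in> genideal monoid_algebra S"
  shows "(\<Union>x\<in>cls R p. cls S (f x)) = cls S (f p)"
proof -
  have "cls S (f x) = cls S (f p)" if "x \<in> cls R p" for x
    using that assms(2) [of "x - p"] by (simp add: cls_eq_iff mem_cls_iff assms(1))
  moreover have "p \<in> cls R p" by simp
  ultimately show ?thesis by blast
qed

section \<open>Linear extension\<close>

text \<open>Common form of \<open>free_hom\<close>, \<open>free_antihom\<close>,
  \<open>free_tensor\<close> and \<open>h0_of\<close>. A conjugating \<open>s\<close> gives a
  conjugate-linear extension.\<close>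

definition lin_ext :: "(complex \<Rightarrow> 'b::semiring_1) \<Rightarrow> ('k \<Rightarrow> 'b) \<Rightarrow> ('k \<Rightarrow>\<^sub>0 complex) \<Rightarrow> 'b" where
  "lin_ext s h p = (\<Sum>k\<in>Poly_Mapping.keys p. s (Poly_Mapping.lookup p k) * h k)"

text \<open>Updating at a fresh key is the same as adding a monomial there, so linear identities
  need only be checked on monomials.\<close>

lemma poly_mapping_sum_induct [case_names zero single add]:
  fixes p :: "'k \<Rightarrow>\<^sub>0 'a::comm_monoid_add"
  assumes "P 0" "\<And>k c. P (Poly_Mapping.single k c)" "\<And>p q. P p \<Longrightarrow> P q \<Longrightarrow> P (p + q)"
  shows "P p"
proof (induct p rule: update_induct)
  case (update f a b)
  have "Poly_Mapping.update a b f = f + Poly_Mapping.single a b"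
    using update(1) by (intro poly_mapping_eqI)
      (auto simp: lookup_update lookup_add lookup_single not_in_keys_iff_lookup_eq_zero when_def)
  with update(3) show ?case using assms by simp
qed (rule assms)

lemma lin_ext_superset:
  assumes "finite A" "Poly_Mapping.keys p \<subseteq> A" "s 0 = 0"
  shows "lin_ext s h p = (\<Sum>k\<in>A. s (Poly_Mapping.lookup p k) * h k)"
  unfolding lin_ext_def by (rule sum.mono_neutral_left) (use assms in \<open>auto simp: in_keys_iff\<close>)

lemma lin_ext_0 [simp]: "lin_ext s h 0 = 0"
  by (simp add: lin_ext_def)

lemma lin_ext_single: "s 0 = 0 \<Longrightarrow> lin_ext s h (Poly_Mapping.single k c) = s c * h k"
  by (subst lin_ext_superset [where A = "{k}"]) auto

lemma lin_ext_add:
  assumes "s 0 = 0" "\<And>a b. s (a + b) = s a + s b"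
  shows "lin_ext s h (p + q) = lin_ext s h p + lin_ext s h q"
proof -
  let ?A = "Poly_Mapping.keys p \<union> Poly_Mapping.keys q"
  have "lin_ext s h x = (\<Sum>k\<in>?A. s (Poly_Mapping.lookup x k) * h k)"
    if "Poly_Mapping.keys x \<subseteq> ?A" for x
    using that assms(1) by (intro lin_ext_superset) auto
  then show ?thesis
    using keys_add [of p q] by (simp add: lookup_add assms(2) distrib_right sum.distrib)
qed

section \<open>Central scalars and structural induction on free algebras\<close>

lemma const_0 [simp]: "const 0 = 0" and const_1 [simp]: "const 1 = 1"
  and const_add: "const (a + b) = const a + const b"
  and const_mult: "const (a * b) = const a * const b"
  and const_uminus: "const (- a) = - const a"
  by (simp_all add: const_def single_add mult_single single_uminus)

lemma const_commute: "p * const c = const c * p"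
  by (induct p rule: poly_mapping_sum_induct) (simp_all add: const_def mult_single algebra_simps)

lemma const_left_commute: "p * (const c * q) = const c * (p * q)"
  by (metis const_commute mult.assoc)

lemma lin_ext_const_single: "lin_ext const h (Poly_Mapping.single k c) = const c * h k"
  by (rule lin_ext_single) simp

lemma lin_ext_const_add: "lin_ext const h (p + q) = lin_ext const h p + lin_ext const h q"
  by (rule lin_ext_add) (simp_all add: const_add)

lemma lin_ext_const_scale:
  fixes p :: "'k::monoid_add \<Rightarrow>\<^sub>0 complex"
  shows "lin_ext const h (const c * p) = const c * lin_ext const h p"
proof (induct p rule: poly_mapping_sum_induct)
  case (single k d)
  have "const c * Poly_Mapping.single k d = Poly_Mapping.single k (c * d)"
    by (simp add: const_def mult_single)
  then show ?case by (simp add: lin_ext_const_single const_mult mult.assoc)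
qed (simp_all add: distrib_left lin_ext_const_add)

lemma single_eq_const: "Poly_Mapping.single k c = const c * Poly_Mapping.single k 1"
  by (simp add: const_def mult_single)

lemma free_algebra_induct [case_names zero one gen scale add]:
  fixes x :: "'g list \<Rightarrow>\<^sub>0 complex"
  assumes "P 0" and one: "P 1" and gen: "\<And>g x. P x \<Longrightarrow> P (gen g * x)"
    and scale: "\<And>c x. P x \<Longrightarrow> P (const c * x)" and "\<And>x y. P x \<Longrightarrow> P y \<Longrightarrow> P (x + y)"
  shows "P x"
proof (induct x rule: poly_mapping_sum_induct)
  case (single u c)
  have "P (Poly_Mapping.single u 1)"
  proof (induct u)
    case Nil
    then show ?case using one by (metis single_one zero_list_def)
  next
    case (Cons g u)
    have "Poly_Mapping.single (g # u) 1 = gen g * Poly_Mapping.single u 1"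
      by (simp add: gen_def mult_single plus_list_def)
    then show ?case using gen [OF Cons] by simp
  qed
  then show ?case by (subst single_eq_const) (rule scale)
qed (rule assms)+

lemma free_comm_algebra_induct [case_names zero one gen scale add]:
  fixes x :: "('g \<Rightarrow>\<^sub>0 nat) \<Rightarrow>\<^sub>0 complex"
  assumes "P 0" and one: "P 1" and gen: "\<And>g x. P x \<Longrightarrow> P (cgen g * x)"
    and scale: "\<And>c x. P x \<Longrightarrow> P (const c * x)" and "\<And>x y. P x \<Longrightarrow> P y \<Longrightarrow> P (x + y)"
  shows "P x"
proof (induct x rule: poly_mapping_sum_induct)
  case (single u c)
  have step: "P (Poly_Mapping.single (Poly_Mapping.single g n + v) 1)" if "P (Poly_Mapping.single v 1)"
    for g n and v :: "'g \<Rightarrow>\<^sub>0 nat"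
  proof (induct n)
    case (Suc n)
    have "Poly_Mapping.single g (Suc n) + v = Poly_Mapping.single g 1 + (Poly_Mapping.single g n + v)"
      by (simp add: single_add [symmetric] add.assoc [symmetric])
    then have "Poly_Mapping.single (Poly_Mapping.single g (Suc n) + v) 1 =
        cgen g * Poly_Mapping.single (Poly_Mapping.single g n + v) (1::complex)"
      by (simp add: cgen_def mult_single)
    then show ?case using gen [OF Suc] by simp
  qed (simp add: that)
  \<comment> \<open>The exponent \<open>u\<close> is itself a finitely supported function, so a
    second induction runs over it. The cofactor \<open>v\<close> lets the hypotheses for two
    summands of \<open>u\<close> be applied one after the other.\<close>
  have "\<forall>v. P (Poly_Mapping.single v 1) \<longrightarrow> P (Poly_Mapping.single (u + v) 1)"
    by (induct u rule: poly_mapping_sum_induct) (simp_all add: step add.assoc)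
  moreover have "P (Poly_Mapping.single 0 1)" using one by simp
  ultimately have "P (Poly_Mapping.single u 1)" by (metis add.right_neutral)
  then show ?case by (subst single_eq_const) (rule scale)
qed (rule assms)+

subsection \<open>Homomorphisms on the free algebra\<close>

lemma free_hom_eq: "free_hom s f = lin_ext s (\<lambda>u. prod_list (map f u))"
  by (rule ext) (simp add: free_hom_def lin_ext_def)

lemma free_antihom_eq: "free_antihom s f = lin_ext s (\<lambda>u. prod_list (map f (rev u)))"
  by (rule ext) (simp add: free_antihom_def lin_ext_def)

text \<open>A unital ring homomorphism from the complex numbers into the centre. It is instantiated
  with \<open>const\<close>, its conjugate, \<open>id\<close> and the constant polynomials.\<close>

locale scalar_map =
  fixes s :: "complex \<Rightarrow> 'b::ring_1"
  assumes s_0: "s 0 = 0" and s_1: "s 1 = 1" and s_add: "s (a + b) = s a + s b"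
    and s_mult: "s (a * b) = s a * s b" and s_central: "y * s a = s a * y"
begin

lemma free_hom_0 [simp]: "free_hom s f 0 = 0"
  and free_hom_add: "free_hom s f (p + q) = free_hom s f p + free_hom s f q"
  and free_antihom_0 [simp]: "free_antihom s f 0 = 0"
  and free_antihom_add: "free_antihom s f (p + q) = free_antihom s f p + free_antihom s f q"
  by (simp_all add: free_hom_eq free_antihom_eq lin_ext_add s_0 s_add)

lemma free_hom_uminus: "free_hom s f (- p) = - free_hom s f p"
  using free_hom_add [of f p "-p"] minus_unique by force

lemma free_antihom_uminus: "free_antihom s f (- p) = - free_antihom s f p"
  using free_antihom_add [of f p "-p"] minus_unique by force

lemma free_hom_diff: "free_hom s f (p - q) = free_hom s f p - free_hom s f q"
  using free_hom_add [of f p "-q"] by (simp add: free_hom_uminus)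

lemma free_antihom_diff: "free_antihom s f (p - q) = free_antihom s f p - free_antihom s f q"
  using free_antihom_add [of f p "-q"] by (simp add: free_antihom_uminus)

lemma s_left_commute: "y * (s a * z) = s a * (y * z)"
  by (metis s_central mult.assoc)

lemma free_hom_mult: "free_hom s f (p * q) = free_hom s f p * free_hom s f q"
proof (induct p rule: poly_mapping_sum_induct)
  case (single u c)
  show ?case
  proof (induct q rule: poly_mapping_sum_induct)
    case (single v d)
    show ?case
      by (simp add: mult_single free_hom_eq lin_ext_single s_0 s_mult plus_list_def mult.assoc
          s_left_commute [of "prod_list _"])
  qed (simp_all add: free_hom_add distrib_left)
qed (simp_all add: free_hom_add distrib_right)

lemma free_antihom_mult: "free_antihom s f (p * q) = free_antihom s f q * free_antihom s f p"
proof (induct p rule: poly_mapping_sum_induct)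
  case (single u c)
  show ?case
  proof (induct q rule: poly_mapping_sum_induct)
    case (single v d)
    show ?case
      by (simp add: mult_single free_antihom_eq lin_ext_single s_0 s_mult plus_list_def mult.assoc
          s_left_commute [of "prod_list _"]
          s_left_commute [of "s d" c])
  qed (simp_all add: free_antihom_add distrib_left distrib_right)
qed (simp_all add: free_antihom_add distrib_left distrib_right)

lemma free_hom_gen [simp]: "free_hom s f (gen g) = f g"
  and free_antihom_gen [simp]: "free_antihom s f (gen g) = f g"
  by (simp_all add: gen_def free_hom_eq free_antihom_eq lin_ext_single s_0 s_1)

lemma free_hom_const [simp]: "free_hom s f (const c) = s c"
  and free_antihom_const [simp]: "free_antihom s f (const c) = s c"
  by (simp_all add: const_def free_hom_eq free_antihom_eq lin_ext_single s_0 zero_list_def)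

lemma free_hom_1 [simp]: "free_hom s f 1 = 1"
  and free_antihom_1 [simp]: "free_antihom s f 1 = 1"
  using free_hom_const [of f 1] free_antihom_const [of f 1] by (simp_all add: s_1 del: free_hom_const free_antihom_const)

lemmas free_hom_simps = free_hom_add free_hom_diff free_hom_uminus free_hom_mult
lemmas free_antihom_simps = free_antihom_add free_antihom_diff free_antihom_uminus free_antihom_mult

end

lemma scalar_map_const: "scalar_map (const :: complex \<Rightarrow> 'k::monoid_add \<Rightarrow>\<^sub>0 complex)"
  by standard (simp_all add: const_add const_mult, rule const_commute)

lemma scalar_map_const_cnj: "scalar_map (\<lambda>c. const (cnj c) :: 'k::monoid_add \<Rightarrow>\<^sub>0 complex)"
  by standard (simp_all add: const_add const_mult, rule const_commute)

lemma scalar_map_id: "scalar_map (id :: complex \<Rightarrow> complex)"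
  by standard simp_all

section \<open>Laurent polynomials\<close>

text \<open>The element \<^term>\<open>Poly_Mapping.single l 1\<close> of \<^typ>\<open>int \<Rightarrow>\<^sub>0 complex\<close> plays the role of
  the power \<open>l\<close> of \<open>chi\<close>.\<close>

type_synonym laurent = "int \<Rightarrow>\<^sub>0 complex"

lemma lookup_map_cnj [simp]: "Poly_Mapping.lookup (Poly_Mapping.map cnj p) k = cnj (Poly_Mapping.lookup p k)"
  by (simp add: Poly_Mapping.map.rep_eq when_def)

lemma map_cnj_add: "Poly_Mapping.map cnj (p + q) = Poly_Mapping.map cnj p + Poly_Mapping.map cnj q"
  and map_cnj_diff: "Poly_Mapping.map cnj (p - q) = Poly_Mapping.map cnj p - Poly_Mapping.map cnj q"
  and map_cnj_0 [simp]: "Poly_Mapping.map cnj 0 = 0"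
  by (rule poly_mapping_eqI; simp add: lookup_add lookup_minus)+

lemma map_cnj_const [simp]: "Poly_Mapping.map cnj (const c) = const (cnj c)"
  by (simp add: const_def)

lemma map_cnj_1 [simp]: "Poly_Mapping.map cnj (1 :: 'k::monoid_add \<Rightarrow>\<^sub>0 complex) = 1"
  using map_cnj_const [of 1] by (simp del: map_cnj_const)

lemma map_cnj_mult:
  fixes p q :: "'k::monoid_add \<Rightarrow>\<^sub>0 complex"
  shows "Poly_Mapping.map cnj (p * q) = Poly_Mapping.map cnj p * Poly_Mapping.map cnj q"
proof (induct p rule: poly_mapping_sum_induct)
  case (single k c)
  show ?case
    by (induct q rule: poly_mapping_sum_induct) (simp_all add: mult_single map_cnj_add distrib_left)
qed (simp_all add: map_cnj_add distrib_right)

lemma map_cnj_power: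
  fixes p :: "'k::monoid_add \<Rightarrow>\<^sub>0 complex"
  shows "Poly_Mapping.map cnj (p ^ n) = Poly_Mapping.map cnj p ^ n"
  by (induct n) (simp_all add: map_cnj_mult)

lemma lookup_mult_single:
  fixes f :: laurent
  shows "Poly_Mapping.lookup (f * Poly_Mapping.single k c) l = Poly_Mapping.lookup f (l - k) * c"
  by (induct f rule: poly_mapping_sum_induct)
    (auto simp: mult_single lookup_single lookup_add distrib_right when_def)

subsection \<open>The derivation\<close>

text \<open>This is \<kappa> \<chi>^2 d/d\<chi> on Laurent polynomials. The factor \<kappa> is a
  parameter because the involution replaces it by its conjugate.\<close>

definition deriv :: "complex \<Rightarrow> laurent \<Rightarrow> laurent" where
  "deriv \<kappa> = lin_ext const (\<lambda>l. Poly_Mapping.single (l + 1) (\<kappa> * of_int l))"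

lemma deriv_add: "deriv \<kappa> (f + g) = deriv \<kappa> f + deriv \<kappa> g"
  and deriv_scale: "deriv \<kappa> (const c * f) = const c * deriv \<kappa> f"
  and deriv_0 [simp]: "deriv \<kappa> 0 = 0"
  by (simp_all add: deriv_def lin_ext_const_add lin_ext_const_scale)

lemma deriv_single: "deriv \<kappa> (Poly_Mapping.single l c) = Poly_Mapping.single (l + 1) (\<kappa> * of_int l * c)"
  by (simp add: deriv_def lin_ext_const_single) (simp add: const_def mult_single mult_ac)

lemma deriv_1 [simp]: "deriv \<kappa> 1 = 0"
  using deriv_single [of \<kappa> 0 1] by simp

lemma deriv_mult: "deriv \<kappa> (f * g) = deriv \<kappa> f * g + f * deriv \<kappa> g"
proof (induct f rule: poly_mapping_sum_induct)
  case (single k c)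
  show ?case
    by (induct g rule: poly_mapping_sum_induct)
      (simp_all add: mult_single deriv_single deriv_add algebra_simps flip: single_add)
qed (simp_all add: deriv_add algebra_simps)

lemma map_cnj_deriv: "Poly_Mapping.map cnj (deriv \<kappa> f) = deriv (cnj \<kappa>) (Poly_Mapping.map cnj f)"
  by (induct f rule: poly_mapping_sum_induct) (simp_all add: deriv_single deriv_add map_cnj_add)

lemma deriv_uminus: "deriv (- \<kappa>) f = - deriv \<kappa> f"
  by (induct f rule: poly_mapping_sum_induct) (simp_all add: deriv_single deriv_add single_uminus)

lemma deriv_minus: "deriv c (- f) = - deriv c f"
  using deriv_scale [of c "-1" f] by (simp add: const_uminus)

lemma lookup_deriv: "Poly_Mapping.lookup (deriv \<kappa> f) l = \<kappa> * of_int (l - 1) * Poly_Mapping.lookup f (l - 1)"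
  by (induct f rule: poly_mapping_sum_induct)
    (auto simp: deriv_single deriv_add lookup_add lookup_single when_def algebra_simps)

subsection \<open>Top coefficients\<close>

text \<open>Exponents bounded by \<open>a\<close> and \<open>b\<close> add up to
  \<open>a + b\<close> only if both bounds are attained. The bounds need not be attained in the
  support: this matters for a derivative, whose expected top coefficient may vanish.\<close>

lemma lookup_mult_top:
  fixes f g :: laurent
  assumes "\<And>l. l > a \<Longrightarrow> Poly_Mapping.lookup f l = 0" "\<And>l. l > b \<Longrightarrow> Poly_Mapping.lookup g l = 0"
  shows "Poly_Mapping.lookup (f * g) (a + b) = Poly_Mapping.lookup f a * Poly_Mapping.lookup g b"
proof -
  have f: "f = lin_ext const (\<lambda>l. Poly_Mapping.single l 1) f" for f :: laurent
    by (induct f rule: poly_mapping_sum_induct)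
      (simp_all add: lin_ext_const_add lin_ext_const_single flip: single_eq_const)
  have "Poly_Mapping.lookup (f * g) (a + b) =
      (\<Sum>l\<in>Poly_Mapping.keys g. Poly_Mapping.lookup f (a + b - l) * Poly_Mapping.lookup g l)"
    by (subst f [of g]) (simp add: lin_ext_def sum_distrib_left lookup_sum lookup_mult_single
      flip: single_eq_const)
  also have "\<dots> = (\<Sum>l\<in>Poly_Mapping.keys g. if l = b then Poly_Mapping.lookup f a * Poly_Mapping.lookup g b else 0)"
  proof (rule sum.cong)
    fix l assume "l \<in> Poly_Mapping.keys g"
    then have "l \<le> b" using assms(2) [of l] by (auto simp: in_keys_iff not_less [symmetric])
    then show "Poly_Mapping.lookup f (a + b - l) * Poly_Mapping.lookup g l =
        (if l = b then Poly_Mapping.lookup f a * Poly_Mapping.lookup g b else 0)"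
      using assms(1) [of "a + b - l"] by auto
  qed simp
  also have "\<dots> = Poly_Mapping.lookup f a * Poly_Mapping.lookup g b"
    by (auto simp: sum.delta not_in_keys_iff_lookup_eq_zero)
  finally show ?thesis .
qed

text \<open>Let \<open>a\<close> and \<open>b\<close> be the top degrees of \<open>f\<close> and
  \<open>g\<close>. Their top coefficients multiply to a nonzero coefficient of 1, so
  \<open>a + b = 0\<close> and that product is 1. Differentiation raises the degree by one and
  multiplies the top coefficient by \<kappa> \<open>a\<close>, so \<open>k = a\<close>
  works.\<close>

lemma lookup_log_deriv:
  assumes "f * g = (1 :: laurent)"
  obtains k :: int where "Poly_Mapping.lookup (deriv \<kappa> f * g) 1 = \<kappa> * of_int k"
proof -
  have "f \<noteq> 0" "g \<noteq> 0" using assms by auto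
  then have nonempty: "Poly_Mapping.keys f \<noteq> {}" "Poly_Mapping.keys g \<noteq> {}" by simp_all
  define a where "a = Max (Poly_Mapping.keys f)"
  define b where "b = Max (Poly_Mapping.keys g)"
  have a: "Poly_Mapping.lookup f a \<noteq> 0" and b: "Poly_Mapping.lookup g b \<noteq> 0"
    using Max_in [OF _ nonempty(1)] Max_in [OF _ nonempty(2)] by (auto simp: a_def b_def in_keys_iff)
  have top_f: "Poly_Mapping.lookup f l = 0" if "l > a" for l
    using that Max_ge [of "Poly_Mapping.keys f" l] by (fastforce simp: a_def in_keys_iff)
  have top_g: "Poly_Mapping.lookup g l = 0" if "l > b" for l
    using that Max_ge [of "Poly_Mapping.keys g" l] by (fastforce simp: b_def in_keys_iff)
  have prod: "Poly_Mapping.lookup (1 :: laurent) (a + b) = Poly_Mapping.lookup f a * Poly_Mapping.lookup g b"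
    using lookup_mult_top [OF top_f top_g] by (simp add: assms)
  with a b have ab: "a + b = 0" by (auto simp: lookup_one when_def split: if_splits)
  have "Poly_Mapping.lookup (deriv \<kappa> f * g) (a + 1 + b) =
      Poly_Mapping.lookup (deriv \<kappa> f) (a + 1) * Poly_Mapping.lookup g b"
    by (rule lookup_mult_top) (simp_all add: lookup_deriv top_f top_g)
  also have "\<dots> = \<kappa> * of_int a" using prod ab by (simp add: lookup_deriv)
  also have "a + 1 + b = 1" using ab by simp
  finally show ?thesis by (rule that)
qed

subsection \<open>Polynomials in an operator\<close>

definition linear_op :: "(laurent \<Rightarrow> laurent) \<Rightarrow> bool" where
  "linear_op E \<longleftrightarrow> (\<forall>f g. E (f + g) = E f + E g) \<and> (\<forall>c f. E (const c * f) = const c * E f)"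

lemma linear_opI:
  "(\<And>f g. E (f + g) = E f + E g) \<Longrightarrow> (\<And>c f. E (const c * f) = const c * E f) \<Longrightarrow> linear_op E"
  by (simp add: linear_op_def)

lemma linear_op_add: "linear_op E \<Longrightarrow> E (f + g) = E f + E g"
  and linear_op_scale: "linear_op E \<Longrightarrow> E (const c * f) = const c * E f"
  by (simp_all add: linear_op_def)

lemma linear_op_0: "linear_op E \<Longrightarrow> E 0 = 0"
  using linear_op_scale [of E 0 0] by simp

text \<open>Horner scheme for \<open>p(E) f\<close>, meant for linear \<open>E\<close>.\<close>

definition poly_op :: "(laurent \<Rightarrow> laurent) \<Rightarrow> complex poly \<Rightarrow> laurent \<Rightarrow> laurent" where
  "poly_op E p f = fold_coeffs (\<lambda>c g. const c * f + E g) p 0"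

lemma poly_op_0 [simp]: "poly_op E 0 f = 0"
  by (simp add: poly_op_def)

lemma poly_op_pCons:
  assumes "linear_op E"
  shows "poly_op E (pCons c p) f = const c * f + E (poly_op E p f)"
  \<comment> \<open>The recursion of \<open>fold_coeffs\<close> excludes the case where both
    \<open>p\<close> and \<open>c\<close> vanish; there the equation rests on
    \<open>E 0 = 0\<close>.\<close>
  by (cases "p = 0 \<and> c = 0") (auto simp: poly_op_def linear_op_0 [OF assms])

lemma poly_op_1: "linear_op E \<Longrightarrow> poly_op E 1 f = f"
  by (simp add: one_pCons poly_op_pCons linear_op_0)

lemma poly_op_add:
  assumes "linear_op E"
  shows "poly_op E (p + q) f = poly_op E p f + poly_op E q f"
  by (induct p q rule: poly_induct2)
    (simp_all add: poly_op_pCons [OF assms] linear_op_add [OF assms] const_add algebra_simps)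

lemma poly_op_smult:
  assumes "linear_op E"
  shows "poly_op E (smult c p) f = const c * poly_op E p f"
  by (induct p)
    (simp_all add: poly_op_pCons [OF assms] linear_op_scale [OF assms] const_mult algebra_simps)

lemma linear_op_poly_op:
  assumes "linear_op E"
  shows "linear_op (poly_op E p)"
proof (rule linear_opI)
  show "poly_op E p (f + g) = poly_op E p f + poly_op E p g" for f g
    by (induct p) (simp_all add: poly_op_pCons [OF assms] linear_op_add [OF assms] algebra_simps)
  show "poly_op E p (const c * f) = const c * poly_op E p f" for c f
    by (induct p) (simp_all add: poly_op_pCons [OF assms] linear_op_scale [OF assms] algebra_simps)
qed

lemma poly_op_mult:
  assumes "linear_op E"
  shows "poly_op E (p * q) f = poly_op E p (poly_op E q f)"
  by (induct p)
    (simp_all add: poly_op_pCons [OF assms] poly_op_add [OF assms] poly_op_smult [OF assms])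

text \<open>\<open>E\<close> is itself \<open>poly_op E [:0, 1:]\<close>, and polynomials
  commute.\<close>

lemma poly_op_commute:
  assumes "linear_op E"
  shows "poly_op E p (E f) = E (poly_op E p f)"
  using poly_op_mult [OF assms, of p "[:0, 1:]" f] poly_op_mult [OF assms, of "[:0, 1:]" p f]
  by (simp add: poly_op_pCons [OF assms] linear_op_0 [OF assms])

lemma poly_op_sum:
  assumes "linear_op E" "finite A"
  shows "poly_op E (sum p A) f = (\<Sum>i\<in>A. poly_op E (p i) f)"
  using assms(2) by induct (simp_all add: poly_op_add [OF assms(1)])

lemma poly_op_monom:
  assumes "linear_op E"
  shows "poly_op E (monom c n) f = const c * (E ^^ n) f"
  by (induct n)
    (simp_all add: monom_0 monom_Suc poly_op_pCons [OF assms] linear_op_0 [OF assms] linear_op_scale [OF assms])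

lemma poly_op_expand:
  assumes "linear_op E"
  shows "poly_op E p f = (\<Sum>i\<le>degree p. const (coeff p i) * (E ^^ i) f)"
proof -
  have "poly_op E p f = poly_op E (\<Sum>i\<le>degree p. monom (coeff p i) i) f"
    by (simp only: poly_as_sum_of_monoms)
  then show ?thesis by (simp add: poly_op_sum [OF assms] poly_op_monom [OF assms])
qed

section \<open>The algebra spanned by the powers of \<open>chi\<close>\<close>

text \<open>Negative powers use the inverse 1 - wm v0 of \<chi>, so every power has a representative
  that is a polynomial in the generators. Exponents add only modulo the relator.\<close>

definition chi_power :: "real \<Rightarrow> real \<Rightarrow> int \<Rightarrow> h0_free" where
  "chi_power w m l =
    (if l < 0 then (1 - const (of_real (w * m)) * cgen Gen_v0) ^ nat (- l)
     else (1 + const (of_real (w * m)) * cgen Gen_v1) ^ nat l)"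

text \<open>Evaluation of Laurent polynomials at \<chi>. It turns out to be surjective
  (\<open>carrier_H0\<close>) and, given \<nu>, injective (\<open>inj_h0_of\<close>), so all
  computations can be made with Laurent polynomials.\<close>

definition h0_of :: "real \<Rightarrow> real \<Rightarrow> laurent \<Rightarrow> h0_free set" where
  "h0_of w m f = cls (h0_relators w m) (lin_ext const (chi_power w m) f)"

context
  fixes w m :: real
begin

abbreviation (input) hcls where "hcls \<equiv> cls (h0_relators w m)"

text \<open>The product minus 1 is -wm times the relator.\<close>

lemma chi_inverse:
  "hcls ((1 + const (of_real (w * m)) * cgen Gen_v1) * (1 - const (of_real (w * m)) * cgen Gen_v0)) = hcls 1"
proof -
  let ?r = "const (of_real (w * m)) * cgen Gen_v0 * cgen Gen_v1 - (cgen Gen_v1 - cgen Gen_v0)"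
  have "(1 + const (of_real (w * m)) * cgen Gen_v1) * (1 - const (of_real (w * m)) * cgen Gen_v0) - 1 =
      - const (of_real (w * m)) * ?r"
    by (simp add: algebra_simps)
  moreover have "?r \<in> genideal monoid_algebra (h0_relators w m)"
    by (rule genideal_relator) (simp add: h0_relators_def)
  ultimately show ?thesis by (simp only: cls_eq_iff genideal_mult_left)
qed

lemma chi_int_pow: "chi w m [^]\<^bsub>H0 w m\<^esub> l = hcls (chi_power w m l)" for l :: int
proof -
  have "chi w m = hcls (1 + const (of_real (w * m)) * cgen Gen_v1)"
    by (simp add: chi_def h0_v1_def)
  then show ?thesis
    using cls_int_pow [OF chi_inverse chi_inverse [unfolded mult.commute [of "1 + _"]], of l]
    by (simp add: chi_power_def)
qed

lemma chi_power_Suc: "hcls (chi_power w m (l + 1)) = hcls (chi_power w m 1 * chi_power w m l)"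
proof (cases "l < 0")
  case True
  then obtain n where l: "l = - int (Suc n)"
    by (metis neg_less_0_iff_less int_nat_eq add.inverse_inverse negD)
  have "chi_power w m l = (1 - const (of_real (w * m)) * cgen Gen_v0) * chi_power w m (l + 1)"
    by (cases n) (simp_all add: chi_power_def l nat_add_distrib)
  then have eq: "chi_power w m 1 * chi_power w m l =
      (chi_power w m 1 * (1 - const (of_real (w * m)) * cgen Gen_v0)) * chi_power w m (l + 1)"
    by (simp only: mult.assoc)
  have "hcls (chi_power w m 1 * chi_power w m l) = hcls (1 * chi_power w m (l + 1))"
    unfolding eq by (rule cls_mult_cong) (use chi_inverse in \<open>simp_all add: chi_power_def\<close>)
  then show ?thesis by simp
next
  case False
  then show ?thesis by (simp add: chi_power_def nat_add_distrib)
qed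

lemma chi_power_add: "hcls (chi_power w m (k + l)) = hcls (chi_power w m k * chi_power w m l)"
proof (induct k rule: int_induct [where k = 0])
  case base
  then show ?case by (simp add: chi_power_def)
next
  case (step1 k)
  have "hcls (chi_power w m (k + 1 + l)) = hcls (chi_power w m 1 * chi_power w m (k + l))"
    using chi_power_Suc [of "k + l"] by (simp add: add_ac)
  also have "\<dots> = hcls (chi_power w m 1 * (chi_power w m k * chi_power w m l))"
    by (rule cls_mult_cong) (simp_all add: step1)
  also have "\<dots> = hcls ((chi_power w m 1 * chi_power w m k) * chi_power w m l)"
    by (simp add: mult.assoc)
  also have "\<dots> = hcls (chi_power w m (k + 1) * chi_power w m l)"
    by (rule cls_mult_cong) (simp_all add: chi_power_Suc)
  finally show ?case .
next
  case (step2 k)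
  let ?y = "1 - const (of_real (w * m)) * cgen Gen_v0"
  \<comment> \<open>Multiplying the upward recursion by the inverse of \<chi> gives the downward
    one.\<close>
  have down: "hcls (chi_power w m (j - 1)) = hcls (?y * chi_power w m j)" for j
  proof -
    have "hcls (?y * chi_power w m j) = hcls (?y * (chi_power w m 1 * chi_power w m (j - 1)))"
      by (rule cls_mult_cong) (use chi_power_Suc [of "j - 1"] in simp_all)
    also have "\<dots> = hcls ((chi_power w m 1 * ?y) * chi_power w m (j - 1))"
      by (simp add: mult_ac)
    also have "\<dots> = hcls (1 * chi_power w m (j - 1))"
      by (rule cls_mult_cong) (use chi_inverse in \<open>simp_all add: chi_power_def\<close>)
    finally show ?thesis by simp
  qed
  have "hcls (chi_power w m (k - 1 + l)) = hcls (?y * chi_power w m (k + l))"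
    using down [of "k + l"] by (simp add: algebra_simps)
  also have "\<dots> = hcls (?y * (chi_power w m k * chi_power w m l))"
    by (rule cls_mult_cong) (simp_all add: step2)
  also have "\<dots> = hcls ((?y * chi_power w m k) * chi_power w m l)"
    by (simp add: mult.assoc)
  also have "\<dots> = hcls (chi_power w m (k - 1) * chi_power w m l)"
    by (rule cls_mult_cong) (simp_all add: down)
  finally show ?case .
qed

section \<open>Evaluation at \<chi> as a surjective star-homomorphism\<close>

lemma h0_of_add: "h0_of w m f \<oplus>\<^bsub>H0 w m\<^esub> h0_of w m g = h0_of w m (f + g)"
  by (simp add: h0_of_def lin_ext_const_add)

lemma h0_of_scale: "c \<odot>\<^bsub>H0 w m\<^esub> h0_of w m f = h0_of w m (const c * f)"
  by (simp add: h0_of_def lin_ext_const_scale)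

lemma h0_of_single: "h0_of w m (Poly_Mapping.single l c) = c \<odot>\<^bsub>H0 w m\<^esub> (chi w m [^]\<^bsub>H0 w m\<^esub> l)"
  by (simp add: h0_of_def lin_ext_const_single chi_int_pow)

lemma h0_of_0: "\<zero>\<^bsub>H0 w m\<^esub> = h0_of w m 0"
  by (simp add: h0_of_def)

lemma h0_of_1: "\<one>\<^bsub>H0 w m\<^esub> = h0_of w m 1"
  using lin_ext_const_single [of "chi_power w m" 0 1] by (simp add: h0_of_def chi_power_def)

lemma chi_int_pow_h0_of: "chi w m [^]\<^bsub>H0 w m\<^esub> l = h0_of w m (Poly_Mapping.single l 1)" for l :: int
  by (simp add: h0_of_single chi_int_pow)

lemma h0_of_mult: "h0_of w m f \<otimes>\<^bsub>H0 w m\<^esub> h0_of w m g = h0_of w m (f * g)"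
proof -
  let ?L = "lin_ext const (chi_power w m)"
  have "hcls (?L (f * g)) = hcls (?L f * ?L g)"
  proof (induct f rule: poly_mapping_sum_induct)
    case (single k c)
    show ?case
    proof (induct g rule: poly_mapping_sum_induct)
      case (single l d)
      have "hcls (const (c * d) * chi_power w m (k + l)) =
          hcls (const (c * d) * (chi_power w m k * chi_power w m l))"
        by (intro cls_mult_cong chi_power_add refl)
      then show ?case by (simp add: mult_single lin_ext_const_single const_mult mult_ac)
    next
      case (add g h)
      then show ?case unfolding distrib_left lin_ext_const_add by (rule cls_add_cong)
    qed simp
  next
    case (add f h)
    then show ?case unfolding distrib_right lin_ext_const_add by (rule cls_add_cong)
  qed simp
  then show ?thesis by (simp add: h0_of_def)
qed

lemma h0_of_finsum:
  "finite A \<Longrightarrow> (\<Oplus>\<^bsub>H0 w m\<^esub>i\<in>A. h0_of w m (f i)) = h0_of w m (sum f A)"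
proof -
  assume fin: "finite A"
  have "lin_ext const (chi_power w m) (sum f A) = (\<Sum>i\<in>A. lin_ext const (chi_power w m) (f i))"
    using fin by induct (simp_all add: lin_ext_const_add)
  then show ?thesis by (simp add: h0_of_def cls_finsum [OF fin])
qed

lemma h0_of_closed [simp]: "h0_of w m f \<in> carrier (H0 w m)"
  by (simp add: h0_of_def)

lemma h0_of_range [simp]: "h0_of w m f \<in> range (cls (h0_relators w m))"
  by (simp add: h0_of_def)

text \<open>Both generators are recovered from \<chi>: v1 = (\<chi> - 1)/(wm) and v0 = (1 -
  \<chi>^-1)/(wm). The divisions use that \<open>w\<close> and \<open>m\<close> are nonzero.\<close>

lemma carrier_H0:
  assumes "w \<noteq> 0" "m \<noteq> 0"
  shows "carrier (H0 w m) = range (h0_of w m)"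
proof -
  let ?c = "of_real (w * m) :: complex"
  have c: "?c \<noteq> 0" using assms by simp
  have scal: "lin_ext const (chi_power w m) (const d) = const d" for d
    using lin_ext_const_single [of "chi_power w m" 0 d] by (simp add: const_def [of d] chi_power_def)
  have v1: "hcls (cgen Gen_v1) = h0_of w m (const (1 / ?c) * (Poly_Mapping.single 1 1 + const (- 1)))"
  proof -
    have "const (1 / ?c) * (chi_power w m 1 + const (- 1)) = const (1 / ?c) * const ?c * cgen Gen_v1"
      by (simp add: chi_power_def const_uminus mult.assoc del: of_real_mult)
    also have "const (1 / ?c) * const ?c = (1 :: h0_free)"
      using c by (simp del: of_real_mult flip: const_mult)
    finally show ?thesis
      by (simp add: h0_of_def lin_ext_const_scale lin_ext_const_add lin_ext_const_single scal
          del: of_real_mult)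
  qed
  have v0: "hcls (cgen Gen_v0) = h0_of w m (const (1 / ?c) * (const 1 + Poly_Mapping.single (- 1) (- 1)))"
  proof -
    have "const (1 / ?c) * (const 1 + const (- 1) * chi_power w m (- 1)) = const (1 / ?c) * const ?c * cgen Gen_v0"
      by (simp add: chi_power_def const_uminus mult.assoc del: of_real_mult)
    also have "const (1 / ?c) * const ?c = (1 :: h0_free)"
      using c by (simp del: of_real_mult flip: const_mult)
    finally show ?thesis
      by (simp only: h0_of_def lin_ext_const_scale lin_ext_const_add lin_ext_const_single scal mult_1_left)
  qed
  have "hcls p \<in> range (h0_of w m)" for p
  proof (induct p rule: free_comm_algebra_induct)
    case zero
    then show ?case using h0_of_0 by auto
  next
    case one
    then show ?case using h0_of_1 by auto
  next
    case (gen g p)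
    then obtain f where f: "hcls p = h0_of w m f" by auto
    obtain e where e: "hcls (cgen g) = h0_of w m e" using v0 v1 by (cases g) auto
    have "hcls (cgen g * p) = hcls (cgen g) \<otimes>\<^bsub>H0 w m\<^esub> hcls p" by simp
    then show ?case by (simp add: e f h0_of_mult)
  next
    case (scale c p)
    then obtain f where f: "hcls p = h0_of w m f" by auto
    have "hcls (const c * p) = c \<odot>\<^bsub>H0 w m\<^esub> hcls p" by simp
    then show ?case by (simp add: f h0_of_scale)
  next
    case (add p q)
    then obtain f g where fg: "hcls p = h0_of w m f" "hcls q = h0_of w m g" by auto
    have "hcls (p + q) = hcls p \<oplus>\<^bsub>H0 w m\<^esub> hcls q" by simp
    then show ?case by (simp add: fg h0_of_add)
  qed
  then show ?thesis by (auto simp: h0_of_def)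
qed

text \<open>The relator has real coefficients, so conjugating coefficients preserves the ideal; the
  representatives of the powers of \<chi> also have real coefficients and are fixed.\<close>

lemma h0_star_h0_of: "h0_star w m (h0_of w m f) = h0_of w m (Poly_Mapping.map cnj f)"
proof -
  have map_cgen [simp]: "Poly_Mapping.map cnj (cgen g) = cgen g" for g :: h0_gen
    by (simp add: cgen_def)
  have "Poly_Mapping.map cnj r \<in> genideal monoid_algebra (h0_relators w m)"
    if "r \<in> genideal monoid_algebra (h0_relators w m)" for r
    using that
  proof (induct r rule: genideal_induct)
    case (relator r)
    then have "Poly_Mapping.map cnj r = r"
      by (simp add: h0_relators_def map_cnj_mult map_cnj_diff)
    with relator show ?case by (simp add: genideal_relator)
  next
    case zero
    show ?case by (simp add: genideal_0)
  next
    case (add x y)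
    then show ?case by (simp add: map_cnj_add genideal_add)
  next
    case (mult_left a x)
    then show ?case by (simp only: map_cnj_mult genideal_mult_left)
  next
    case (mult_right a x)
    then show ?case by (simp only: map_cnj_mult genideal_mult_right)
  qed
  then have star: "h0_star w m (hcls p) = hcls (Poly_Mapping.map cnj p)" for p
    by (simp add: h0_star_def Union_cls_image [OF map_cnj_diff])
  have power: "Poly_Mapping.map cnj (chi_power w m l) = chi_power w m l" for l
    by (simp add: chi_power_def map_cnj_power map_cnj_diff map_cnj_add map_cnj_mult)
  have "Poly_Mapping.map cnj (lin_ext const (chi_power w m) f) =
      lin_ext const (chi_power w m) (Poly_Mapping.map cnj f)"
    by (induct f rule: poly_mapping_sum_induct)
      (simp_all add: lin_ext_const_single lin_ext_const_add map_cnj_add map_cnj_mult power)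
  then show ?thesis by (simp add: h0_of_def star)
qed

section \<open>Linear independence of the powers of \<chi>\<close>

context
  fixes \<nu> :: "h0_free set \<Rightarrow> complex"
  assumes lin: "linear_functional (H0 w m) \<nu>"
    and nu_chi: "\<And>l::int. \<nu> (chi w m [^]\<^bsub>H0 w m\<^esub> l) = (if l = 0 then 1 else 0)"
begin

lemma functional_h0_of: "\<nu> (h0_of w m f) = Poly_Mapping.lookup f 0"
proof (induct f rule: poly_mapping_sum_induct)
  case zero
  have "\<nu> (0 \<odot>\<^bsub>H0 w m\<^esub> h0_of w m 0) = 0 * \<nu> (h0_of w m 0)"
    using lin h0_of_closed unfolding linear_functional_def by blast
  then show ?case by (simp add: h0_of_scale)
next
  case (single l c)
  have "chi w m [^]\<^bsub>H0 w m\<^esub> l \<in> carrier (H0 w m)"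
    by (simp add: chi_int_pow)
  then have "\<nu> (c \<odot>\<^bsub>H0 w m\<^esub> chi w m [^]\<^bsub>H0 w m\<^esub> l) = c * \<nu> (chi w m [^]\<^bsub>H0 w m\<^esub> l)"
    using lin unfolding linear_functional_def by blast
  then show ?case by (simp only: h0_of_single nu_chi) (simp add: lookup_single when_def)
next
  case (add f g)
  have "\<nu> (h0_of w m f \<oplus>\<^bsub>H0 w m\<^esub> h0_of w m g) = \<nu> (h0_of w m f) + \<nu> (h0_of w m g)"
    using lin h0_of_closed unfolding linear_functional_def by blast
  with add show ?case by (simp add: h0_of_add lookup_add)
qed

text \<open>Multiplying by \<chi>^-k and applying \<nu> reads off the coefficient of
  \<chi>^k.\<close>

lemma inj_h0_of: "inj (h0_of w m)"
proof (rule injI, rule poly_mapping_eqI)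
  fix f g :: laurent and k
  assume "h0_of w m f = h0_of w m g"
  then have "\<nu> (h0_of w m f \<otimes>\<^bsub>H0 w m\<^esub> h0_of w m (Poly_Mapping.single (- k) 1)) =
      \<nu> (h0_of w m g \<otimes>\<^bsub>H0 w m\<^esub> h0_of w m (Poly_Mapping.single (- k) 1))"
    by simp
  then show "Poly_Mapping.lookup f k = Poly_Mapping.lookup g k"
    by (simp add: h0_of_mult functional_h0_of lookup_mult_single)
qed

end

end

section \<open>The quantum Galilei algebra and its symbol map\<close>

definition symbol :: "galilei_free \<Rightarrow> complex poly" where
  "symbol = free_hom (\<lambda>c. [:c:])
     (\<lambda>g. case g of Gen_K \<Rightarrow> 1 | Gen_Kinv \<Rightarrow> 1 | Gen_B \<Rightarrow> [:0, 1:] | Gen_M \<Rightarrow> 0 | Gen_T \<Rightarrow> 0)"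

lemma scalar_map_pCons: "scalar_map (\<lambda>c. [:c:] :: complex poly)"
  by standard (simp_all add: one_pCons)

lemma symbol_add: "symbol (x + y) = symbol x + symbol y"
  and symbol_diff: "symbol (x - y) = symbol x - symbol y"
  and symbol_uminus: "symbol (- x) = - symbol x"
  and symbol_mult: "symbol (x * y) = symbol x * symbol y"
  and symbol_0 [simp]: "symbol 0 = 0"
  and symbol_1 [simp]: "symbol 1 = 1"
  and symbol_const [simp]: "symbol (const c) = [:c:]"
  and symbol_gen [simp]: "symbol (gen Gen_K) = 1" "symbol (gen Gen_Kinv) = 1"
    "symbol (gen Gen_B) = [:0, 1:]" "symbol (gen Gen_M) = 0" "symbol (gen Gen_T) = 0"
proof -
  interpret scalar_map "\<lambda>c. [:c:] :: complex poly" by (rule scalar_map_pCons)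
  show "symbol (x + y) = symbol x + symbol y" "symbol (x - y) = symbol x - symbol y"
    "symbol (- x) = - symbol x" "symbol (x * y) = symbol x * symbol y" "symbol 0 = 0" "symbol 1 = 1"
    "symbol (const c) = [:c:]" "symbol (gen Gen_K) = 1" "symbol (gen Gen_Kinv) = 1"
    "symbol (gen Gen_B) = [:0, 1:]" "symbol (gen Gen_M) = 0" "symbol (gen Gen_T) = 0"
    by (simp_all add: symbol_def free_hom_simps)
qed

lemmas symbol_simps = symbol_add symbol_diff symbol_uminus symbol_mult

lemma symbol_power: "symbol (x ^ n) = symbol x ^ n"
  by (induct n) (simp_all add: symbol_mult)

context
  fixes w :: real
begin

abbreviation (input) "\<K> \<equiv> gen Gen_K"
abbreviation (input) "\<K>' \<equiv> gen Gen_Kinv"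
abbreviation (input) "\<B> \<equiv> gen Gen_B"
abbreviation (input) "\<M> \<equiv> gen Gen_M"
abbreviation (input) "\<T> \<equiv> gen Gen_T"
abbreviation (input) "ucls \<equiv> cls (uq_relators w)"
abbreviation (input) "ucls2 \<equiv> cls (uq2_relators w)"
abbreviation (input) "uideal \<equiv> genideal monoid_algebra (uq_relators w)"
abbreviation (input) "uideal2 \<equiv> genideal monoid_algebra (uq2_relators w)"

lemmas gen_const = const_commute [of "gen _"] const_left_commute [of "gen _"]

section \<open>Consequences of the defining relations\<close>

lemma uq_relator_cases [consumes 1]:
  assumes "r \<in> uq_relators w"
    and "\<And>g. r = \<M> * gen g - gen g * \<M> \<Longrightarrow> P"
    and "r = \<K> * \<K>' - 1 \<Longrightarrow> P" and "r = \<K>' * \<K> - 1 \<Longrightarrow> P" and "r = \<K> * \<T> - \<T> * \<K> \<Longrightarrow> P"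
    and "r = \<K> * \<B> * \<K>' - (\<B> - const (\<i> * of_real w) * \<M>) \<Longrightarrow> P"
    and "r = \<B> * \<T> - \<T> * \<B> - const (\<i> / (2 * of_real w)) * (\<K> - \<K>') \<Longrightarrow> P"
  shows P
  using assms unfolding uq_relators_def Let_def by blast

lemma uq_relations:
  "ucls (\<M> * gen g) = ucls (gen g * \<M>)"
  "ucls (\<K> * \<K>') = ucls 1" "ucls (\<K>' * \<K>) = ucls 1" "ucls (\<K> * \<T>) = ucls (\<T> * \<K>)"
  "ucls (\<K> * \<B> * \<K>') = ucls (\<B> - const (\<i> * of_real w) * \<M>)"
  "ucls (\<B> * \<T>) = ucls (\<T> * \<B> + const (\<i> / (2 * of_real w)) * (\<K> - \<K>'))"
  unfolding cls_eq_iff diff_diff_eq [symmetric]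
  by (rule genideal_relator; unfold uq_relators_def Let_def; blast)+

lemma uq_cong_left: "ucls a = ucls b \<Longrightarrow> ucls (x * a) = ucls (x * b)"
  and uq_cong_right: "ucls a = ucls b \<Longrightarrow> ucls (a * x) = ucls (b * x)"
  by (rule cls_mult_cong; simp)+

lemma uq_M_central: "ucls (\<M> * x) = ucls (x * \<M>)"
proof (induct x rule: free_algebra_induct)
  case (gen g x)
  have "ucls (\<M> * (gen g * x)) = ucls (gen g * \<M> * x)"
    using uq_cong_right [OF uq_relations(1)] by (simp add: mult.assoc)
  also have "\<dots> = ucls (gen g * x * \<M>)"
    using uq_cong_left [OF gen] by (simp add: mult.assoc)
  finally show ?case .
next
  case (scale c x)
  then show ?case using uq_cong_left [OF scale, of "const c"] by (simp add: gen_const mult.assoc)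
next
  case (add x y)
  then show ?case unfolding distrib_left distrib_right by (rule cls_add_cong)
qed simp_all

lemma uq_cancel: "ucls (\<K> * (\<K>' * x)) = ucls x" "ucls (\<K>' * (\<K> * x)) = ucls x"
  "ucls (x * \<K> * \<K>') = ucls x" "ucls (x * \<K>' * \<K>) = ucls x"
  using uq_cong_right [OF uq_relations(2), of x] uq_cong_right [OF uq_relations(3), of x]
    uq_cong_left [OF uq_relations(2), of x] uq_cong_left [OF uq_relations(3), of x]
  by (simp_all add: mult.assoc)

lemma uq_Kinv_T: "ucls (\<K>' * \<T>) = ucls (\<T> * \<K>')"
proof -
  have "ucls (\<K>' * \<T>) = ucls (\<K>' * \<T> * \<K> * \<K>')" by (simp only: uq_cancel)
  also have "\<dots> = ucls (\<K>' * (\<T> * \<K>) * \<K>')" by (simp only: mult.assoc)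
  also have "\<dots> = ucls (\<K>' * (\<K> * \<T>) * \<K>')" by (intro uq_cong_left uq_cong_right uq_relations(4) [symmetric])
  also have "\<dots> = ucls (\<T> * \<K>')" using uq_cancel(2) [of "\<T> * \<K>'"] by (simp only: mult.assoc)
  finally show ?thesis .
qed

lemma uq_K_B: "ucls (\<K> * \<B>) = ucls (\<B> * \<K> - const (\<i> * of_real w) * (\<M> * \<K>))"
proof -
  have "ucls (\<K> * \<B>) = ucls (\<K> * \<B> * \<K>' * \<K>)" by (simp only: uq_cancel)
  also have "\<dots> = ucls ((\<B> - const (\<i> * of_real w) * \<M>) * \<K>)" by (intro uq_cong_right uq_relations)
  finally show ?thesis by (simp add: algebra_simps)
qed

text \<open>The relation \<open>uq_K_B\<close> is sandwiched between two copies of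
  \<open>\<K>'\<close>; moving the correction term to the other side flips its sign.\<close>

lemma uq_Kinv_B: "ucls (\<K>' * \<B>) = ucls (\<B> * \<K>' + const (\<i> * of_real w) * (\<M> * \<K>'))"
proof -
  have "ucls (\<B> * \<K>') = ucls (\<K>' * (\<K> * \<B>) * \<K>')"
    using uq_cancel(2) [of "\<B> * \<K>'"] by (simp only: mult.assoc)
  also have "\<dots> = ucls (\<K>' * (\<B> * \<K> - const (\<i> * of_real w) * (\<M> * \<K>)) * \<K>')"
    by (intro uq_cong_left uq_cong_right uq_K_B)
  also have "\<dots> = ucls (\<K>' * \<B> * \<K> * \<K>' - const (\<i> * of_real w) * (\<K>' * \<M> * \<K> * \<K>'))"
    by (simp add: algebra_simps gen_const)
  also have "\<dots> = ucls (\<K>' * \<B> - const (\<i> * of_real w) * (\<M> * \<K>'))"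
    by (intro cls_diff_cong uq_cong_left) (simp_all only: uq_cancel uq_relations(1))
  finally have "ucls (\<B> * \<K>' + const (\<i> * of_real w) * (\<M> * \<K>')) =
      ucls (\<K>' * \<B> - const (\<i> * of_real w) * (\<M> * \<K>') + const (\<i> * of_real w) * (\<M> * \<K>'))"
    by (rule cls_add_cong) simp
  then show ?thesis by simp
qed

subsection \<open>Involution and antipode\<close>

text \<open>An anti-homomorphism exchanges left and right multiples, which a two-sided ideal
  tolerates, so only relators need to be checked.\<close>

lemma antihom_ideal:
  assumes "scalar_map s" and relator: "\<And>r. r \<in> uq_relators w \<Longrightarrow> free_antihom s f r \<in> genideal monoid_algebra S"
    and r: "r \<in> uideal"
  shows "free_antihom s f r \<in> genideal monoid_algebra (S :: ('k::monoid_add \<Rightarrow>\<^sub>0 complex) set)"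
proof -
  interpret scalar_map s by fact
  show ?thesis using r
  proof (induct r rule: genideal_induct)
    case (relator r)
    then show ?case by (rule assms(2))
  next
    case zero
    show ?case by (simp add: genideal_0)
  next
    case (add x y)
    then show ?case by (simp only: free_antihom_add genideal_add)
  next
    case (mult_left a x)
    then show ?case by (simp only: free_antihom_mult genideal_mult_right)
  next
    case (mult_right a x)
    then show ?case by (simp only: free_antihom_mult genideal_mult_left)
  qed
qed

lemma uq_star_cls: "uq_star w (ucls x) = ucls (free_antihom (\<lambda>c. const (cnj c)) gen x)"
proof -
  interpret scalar_map "\<lambda>c. const (cnj c) :: galilei_free" by (rule scalar_map_const_cnj)
  have "free_antihom (\<lambda>c. const (cnj c)) gen r \<in> uideal" if "r \<in> uq_relators w" for r
    using that
  proof (cases rule: uq_relator_cases)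
    case (1 g)
    then show ?thesis using uq_relations(1) [of g, symmetric]
      by (simp add: free_antihom_simps cls_eq_iff)
  next
    case 2
    then show ?thesis using uq_relations(3) by (simp add: free_antihom_simps cls_eq_iff)
  next
    case 3
    then show ?thesis using uq_relations(2) by (simp add: free_antihom_simps cls_eq_iff)
  next
    case 4
    then show ?thesis using uq_relations(4) [symmetric] by (simp add: free_antihom_simps cls_eq_iff)
  next
    case 5
    \<comment> \<open>The star reverses the product and conjugates iw to -iw, so the image of the
      relator asserts K^-1 B K = B + iw M.\<close>
    have "ucls (\<K>' * \<B> * \<K>) = ucls ((\<B> * \<K>' + const (\<i> * of_real w) * (\<M> * \<K>')) * \<K>)"
      by (intro uq_cong_right uq_Kinv_B)
    also have "\<dots> = ucls (\<B> * \<K>' * \<K> + const (\<i> * of_real w) * (\<M> * \<K>' * \<K>))"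
      by (simp add: algebra_simps)
    also have "\<dots> = ucls (\<B> + const (\<i> * of_real w) * \<M>)"
      by (intro cls_add_cong uq_cong_left uq_cancel)
    finally show ?thesis
      by (simp add: 5 free_antihom_simps cls_eq_iff gen_const const_uminus algebra_simps)
  next
    case 6
    have "ucls (\<T> * \<B> - \<B> * \<T> + const (\<i> / (2 * of_real w)) * (\<K> - \<K>')) =
        ucls (\<T> * \<B> - (\<T> * \<B> + const (\<i> / (2 * of_real w)) * (\<K> - \<K>')) + const (\<i> / (2 * of_real w)) * (\<K> - \<K>'))"
      by (intro cls_add_cong cls_diff_cong refl uq_relations)
    then show ?thesis
      by (simp add: 6 free_antihom_simps cls_eq_iff gen_const const_uminus algebra_simps)
  qed
  then have "free_antihom (\<lambda>c. const (cnj c)) gen r \<in> uideal" if "r \<in> uideal" for r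
    using antihom_ideal [OF scalar_map_const_cnj _ that] by blast
  then show ?thesis
    unfolding uq_star_def by (rule Union_cls_image [OF free_antihom_diff])
qed

lemma uq_antipode_cls: "uq_antipode w (ucls x) = ucls (free_antihom const (antipode_gen w) x)"
proof -
  interpret scalar_map "const :: complex \<Rightarrow> galilei_free" by (rule scalar_map_const)
  have "free_antihom const (antipode_gen w) r \<in> uideal" if "r \<in> uq_relators w" for r
    using that
  proof (cases rule: uq_relator_cases)
    case (1 g)
    then show ?thesis using uq_M_central [of "antipode_gen w g"]
      by (simp add: free_antihom_simps cls_eq_iff)
  next
    case 2
    then show ?thesis using uq_relations(2) by (simp add: free_antihom_simps cls_eq_iff)
  next
    case 3
    then show ?thesis using uq_relations(3) by (simp add: free_antihom_simps cls_eq_iff)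
  next
    case 4
    then show ?thesis using uq_Kinv_T by (simp add: free_antihom_simps cls_eq_iff)
  next
    case 5
    \<comment> \<open>S(K B K^-1) = K (-B + iw M) K^-1 and S(B - iw M) both reduce to -B + 2iw
      M.\<close>
    have "ucls (const (\<i> * of_real w) * (\<K> * \<M> * \<K>') - \<K> * \<B> * \<K>') =
        ucls (const (\<i> * of_real w) * (\<M> * \<K> * \<K>') - (\<B> - const (\<i> * of_real w) * \<M>))"
      by (intro cls_diff_cong uq_cong_left uq_cong_right uq_relations(1) [symmetric] uq_relations(5))
    also have "\<dots> = ucls (const (\<i> * of_real w) * \<M> - (\<B> - const (\<i> * of_real w) * \<M>))"
      by (intro cls_diff_cong uq_cong_left uq_cancel refl)
    finally show ?thesis
      by (simp add: 5 free_antihom_simps cls_eq_iff gen_const algebra_simps)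
  next
    case 6
    let ?d = "const (\<i> / (2 * of_real w))"
    have "ucls (\<T> * \<B> - \<B> * \<T> + const (\<i> * of_real w) * (\<M> * \<T> - \<T> * \<M>) + ?d * (\<K> - \<K>')) =
        ucls (\<T> * \<B> - (\<T> * \<B> + ?d * (\<K> - \<K>')) + const (\<i> * of_real w) * (\<T> * \<M> - \<T> * \<M>) + ?d * (\<K> - \<K>'))"
      by (intro cls_add_cong cls_diff_cong uq_cong_left refl uq_relations)
    then show ?thesis
      by (simp add: 6 free_antihom_simps cls_eq_iff gen_const algebra_simps)
  qed
  then have "free_antihom const (antipode_gen w) r \<in> uideal" if "r \<in> uideal" for r
    using antihom_ideal [OF scalar_map_const _ that] by blast
  then show ?thesis
    unfolding uq_antipode_def by (rule Union_cls_image [OF free_antihom_diff])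
qed

subsection \<open>Tensor square and coproduct\<close>

text \<open>As an iterated linear extension, the tensor product inherits its bilinearity from
  \<open>lin_ext\<close>.\<close>

lemma free_tensor_eq:
  "free_tensor p q = lin_ext const (\<lambda>u. lin_ext const (\<lambda>v. Poly_Mapping.single (u, v) 1) q) p"
proof -
  have "Poly_Mapping.single (u, v) (a * b) = const a * (const b * Poly_Mapping.single (u, v) 1)"
    for u v :: "galilei_gen list" and a b
    by (simp add: const_def mult_single)
  then show ?thesis by (simp only: free_tensor_def lin_ext_def sum_distrib_left)
qed

lemma free_tensor_add_left: "free_tensor (p + p') q = free_tensor p q + free_tensor p' q"
  and free_tensor_scale_left: "free_tensor (const c * p) q = const c * free_tensor p q"
  and free_tensor_0_left [simp]: "free_tensor 0 q = 0"
  by (simp_all add: free_tensor_eq lin_ext_const_add lin_ext_const_scale)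

lemma free_tensor_single:
  "free_tensor (Poly_Mapping.single u a) (Poly_Mapping.single v b) = Poly_Mapping.single (u, v) (a * b)"
  by (simp add: free_tensor_eq lin_ext_const_single) (simp add: const_def mult_single)

lemma free_tensor_0_right [simp]: "free_tensor p 0 = 0"
  by (simp add: free_tensor_def)

lemma free_tensor_add_right: "free_tensor p (q + q') = free_tensor p q + free_tensor p q'"
  by (induct p rule: poly_mapping_sum_induct)
    (simp_all add: free_tensor_add_left, simp add: free_tensor_eq lin_ext_const_single lin_ext_const_add distrib_left)

lemma free_tensor_scale_right: "free_tensor p (const c * q) = const c * free_tensor p q"
proof (induct p rule: poly_mapping_sum_induct)
  case (single u a)
  show ?case
    by (simp add: free_tensor_eq lin_ext_const_single lin_ext_const_scale)
      (simp add: const_commute [of "const a" c] flip: mult.assoc)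
qed (simp_all add: free_tensor_add_left distrib_left)

lemma free_tensor_uminus_left: "free_tensor (- p) q = - free_tensor p q"
  and free_tensor_uminus_right: "free_tensor p (- q) = - free_tensor p q"
  using free_tensor_scale_left [of "-1" p q] free_tensor_scale_right [of p "-1" q]
  by (simp_all add: const_uminus)

lemma free_tensor_diff_left: "free_tensor (p - p') q = free_tensor p q - free_tensor p' q"
  and free_tensor_diff_right: "free_tensor p (q - q') = free_tensor p q - free_tensor p q'"
  using free_tensor_add_left [of p "- p'" q] free_tensor_add_right [of p q "- q'"]
  by (simp_all add: free_tensor_uminus_left free_tensor_uminus_right)

lemmas free_tensor_linear = free_tensor_add_left free_tensor_add_right free_tensor_diff_left
  free_tensor_diff_right free_tensor_scale_left free_tensor_scale_right

lemma free_tensor_1 [simp]: "free_tensor 1 1 = 1"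
  using free_tensor_single [of "[]" 1 "[]" 1] by (simp flip: zero_list_def zero_prod_def)

lemma free_tensor_mult: "free_tensor p q * free_tensor p' q' = free_tensor (p * p') (q * q')"
proof (induct p rule: poly_mapping_sum_induct)
  case (single u a)
  show ?case
  proof (induct q rule: poly_mapping_sum_induct)
    case (single v b)
    show ?case
    proof (induct p' rule: poly_mapping_sum_induct)
      case (single u' a')
      show ?case
      proof (induct q' rule: poly_mapping_sum_induct)
        case (single v' b')
        show ?case by (simp add: free_tensor_single mult_single mult_ac)
      qed (simp_all add: free_tensor_add_right distrib_left)
    qed (simp_all add: free_tensor_add_left distrib_left)
  qed (simp_all add: free_tensor_add_right distrib_right)
qed (simp_all add: free_tensor_add_left distrib_right)

text \<open>Since \<open>free_tensor r q\<close> is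
  \<open>free_tensor r 1 * free_tensor 1 q\<close>, it suffices to treat \<open>q = 1\<close>, where
  multiples of \<open>r\<close> become multiples in the tensor square.\<close>

lemma free_tensor_left_ideal: "r \<in> uideal \<Longrightarrow> free_tensor r q \<in> uideal2"
proof -
  assume "r \<in> uideal"
  then have "free_tensor r 1 \<in> uideal2"
  proof (induct r rule: genideal_induct)
    case (relator r)
    then show ?case by (intro genideal_relator) (auto simp: uq2_relators_def)
  next
    case (mult_left a x)
    then show ?case using genideal_mult_left [of "free_tensor x 1" _ "free_tensor a 1"]
      by (simp add: free_tensor_mult)
  next
    case (mult_right a x)
    then show ?case using genideal_mult_right [of "free_tensor x 1" _ "free_tensor a 1"]
      by (simp add: free_tensor_mult)
  qed (simp_all add: genideal_0 genideal_add free_tensor_add_left)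
  from genideal_mult_right [OF this, of "free_tensor 1 q"] show ?thesis by (simp add: free_tensor_mult)
qed

lemma free_tensor_right_ideal: "r \<in> uideal \<Longrightarrow> free_tensor p r \<in> uideal2"
proof -
  assume "r \<in> uideal"
  then have "free_tensor 1 r \<in> uideal2"
  proof (induct r rule: genideal_induct)
    case (relator r)
    then show ?case by (intro genideal_relator) (auto simp: uq2_relators_def)
  next
    case (mult_left a x)
    then show ?case using genideal_mult_left [of "free_tensor 1 x" _ "free_tensor 1 a"]
      by (simp add: free_tensor_mult)
  next
    case (mult_right a x)
    then show ?case using genideal_mult_right [of "free_tensor 1 x" _ "free_tensor 1 a"]
      by (simp add: free_tensor_mult)
  qed (simp_all add: genideal_0 genideal_add free_tensor_add_right)
  from genideal_mult_left [OF this, of "free_tensor p 1"] show ?thesis by (simp add: free_tensor_mult)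
qed

lemma free_tensor_cong:
  assumes "ucls p = ucls p'" "ucls q = ucls q'"
  shows "ucls2 (free_tensor p q) = ucls2 (free_tensor p' q')"
proof -
  have "free_tensor p q - free_tensor p' q' = free_tensor (p - p') q + free_tensor p' (q - q')"
    by (simp add: free_tensor_linear)
  then show ?thesis
    using assms free_tensor_left_ideal free_tensor_right_ideal by (simp add: cls_eq_iff genideal_add)
qed

lemma uq_tensor_cls: "uq_tensor w (ucls p) (ucls q) = ucls2 (free_tensor p q)"
proof -
  have "ucls2 (free_tensor x y) = ucls2 (free_tensor p q)" if "x \<in> ucls p" "y \<in> ucls q" for x y
    using that by (intro free_tensor_cong cls_eqI)
  moreover have "p \<in> ucls p" "q \<in> ucls q" by simp_all
  ultimately show ?thesis unfolding uq_tensor_def by blast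
qed

text \<open>The image of each relator is expanded into tensors, and each leg is reordered by the
  relations until everything cancels.\<close>

lemma coproduct_relator:
  assumes "r \<in> uq_relators w"
  shows "free_hom const coprod_gen r \<in> uideal2"
proof -
  interpret scalar_map "const :: complex \<Rightarrow> galilei_gen list \<times> galilei_gen list \<Rightarrow>\<^sub>0 complex"
    by (rule scalar_map_const)
  note cong = cls_add_cong cls_diff_cong free_tensor_cong
  let ?c = "const (\<i> * of_real w)"
  let ?d = "const (\<i> / (2 * of_real w))"
  have KKinv: "ucls (\<K> * \<K>') = ucls (\<K>' * \<K>)" by (simp add: uq_relations)
  from assms show ?thesis
  proof (cases rule: uq_relator_cases)
    case (1 g)
    have "ucls2 (coprod_gen Gen_M * coprod_gen g) = ucls2 (coprod_gen g * coprod_gen Gen_M)"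
    proof (cases g)
      case Gen_K
      show ?thesis unfolding Gen_K coprod_gen.simps distrib_left distrib_right free_tensor_mult
        by (intro cong uq_relations refl KKinv [symmetric])
    next
      case Gen_Kinv
      show ?thesis unfolding Gen_Kinv coprod_gen.simps distrib_left distrib_right free_tensor_mult
        by (intro cong uq_relations refl KKinv)
    next
      case Gen_B
      have "ucls2 (coprod_gen Gen_M * coprod_gen g) = ucls2
          (free_tensor (\<M> * \<B>) (\<K> * \<K>) + free_tensor (\<K>' * \<B>) (\<M> * \<K>) +
          (free_tensor (\<M> * \<K>') (\<K> * \<B>) + free_tensor (\<K>' * \<K>') (\<M> * \<B>)))"
        unfolding Gen_B coprod_gen.simps distrib_left distrib_right free_tensor_mult ..
      \<comment> \<open>The corrections from K^-1 B in the first leg and K B in the second are iw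
        and -iw times the same tensor of M K^-1 with M K, so they cancel.\<close>
      also have "\<dots> = ucls2
          (free_tensor (\<B> * \<M>) (\<K> * \<K>) + free_tensor (\<B> * \<K>' + ?c * (\<M> * \<K>')) (\<M> * \<K>) +
          (free_tensor (\<M> * \<K>') (\<B> * \<K> - ?c * (\<M> * \<K>)) + free_tensor (\<K>' * \<K>') (\<B> * \<M>)))"
        by (intro cong uq_relations refl uq_K_B uq_Kinv_B)
      also have "\<dots> = ucls2
          (free_tensor (\<B> * \<M>) (\<K> * \<K>) + free_tensor (\<B> * \<K>') (\<M> * \<K>) +
          (free_tensor (\<M> * \<K>') (\<B> * \<K>) + free_tensor (\<K>' * \<K>') (\<B> * \<M>)))"
        by (simp add: free_tensor_linear algebra_simps)
      also have "\<dots> = ucls2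
          (free_tensor (\<B> * \<M>) (\<K> * \<K>) + free_tensor (\<B> * \<K>') (\<K> * \<M>) +
          (free_tensor (\<K>' * \<M>) (\<B> * \<K>) + free_tensor (\<K>' * \<K>') (\<B> * \<M>)))"
        by (intro cong uq_relations refl)
      also have "\<dots> = ucls2 (coprod_gen g * coprod_gen Gen_M)"
        unfolding Gen_B coprod_gen.simps distrib_left distrib_right free_tensor_mult
        by (simp add: algebra_simps)
      finally show ?thesis .
    next
      case Gen_T
      have "ucls2 (coprod_gen Gen_M * coprod_gen g) = ucls2
          (free_tensor (\<M> * \<T>) \<K> + free_tensor (\<K>' * \<T>) \<M> +
          (free_tensor \<M> (\<K> * \<T>) + free_tensor \<K>' (\<M> * \<T>)))"
        unfolding Gen_T coprod_gen.simps distrib_left distrib_right free_tensor_mult by simp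
      also have "\<dots> = ucls2
          (free_tensor (\<T> * \<M>) \<K> + free_tensor (\<T> * \<K>') \<M> +
          (free_tensor \<M> (\<T> * \<K>) + free_tensor \<K>' (\<T> * \<M>)))"
        by (intro cong uq_relations uq_Kinv_T refl)
      also have "\<dots> = ucls2 (coprod_gen g * coprod_gen Gen_M)"
        unfolding Gen_T coprod_gen.simps distrib_left distrib_right free_tensor_mult
        by (simp add: algebra_simps)
      finally show ?thesis .
    qed simp
    then show ?thesis using 1 by (simp add: free_hom_simps cls_eq_iff)
  next
    case 2
    have "ucls2 (free_tensor (\<K> * \<K>') (\<K> * \<K>')) = ucls2 (free_tensor 1 1)"
      by (intro cong uq_relations)
    then show ?thesis using 2 by (simp add: free_hom_simps free_tensor_mult cls_eq_iff)
  next
    case 3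
    have "ucls2 (free_tensor (\<K>' * \<K>) (\<K>' * \<K>)) = ucls2 (free_tensor 1 1)"
      by (intro cong uq_relations)
    then show ?thesis using 3 by (simp add: free_hom_simps free_tensor_mult cls_eq_iff)
  next
    case 4
    have "ucls2 (free_tensor (\<K> * \<T>) \<K> + free_tensor \<K> (\<K> * \<T>)) =
        ucls2 (free_tensor (\<T> * \<K>) \<K> + free_tensor \<K> (\<T> * \<K>))"
      by (intro cong uq_relations refl)
    then show ?thesis
      using 4 by (simp add: free_hom_simps free_tensor_mult cls_eq_iff distrib_left distrib_right)
  next
    case 5
    have "ucls2 (free_tensor (\<K> * \<B> * \<K>') (\<K> * \<K> * \<K>') + free_tensor (\<K> * \<K>' * \<K>') (\<K> * \<B> * \<K>')) =
        ucls2 (free_tensor (\<B> - ?c * \<M>) \<K> + free_tensor \<K>' (\<B> - ?c * \<M>))"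
      by (intro cong uq_relations uq_cancel)
        (use uq_cancel(1) [of \<K>'] in \<open>simp add: mult.assoc\<close>)
    then show ?thesis
      unfolding 5 cls_eq_iff by (simp add: free_hom_simps free_tensor_mult free_tensor_linear algebra_simps)
  next
    case 6
    \<comment> \<open>The two commutator terms telescope: (K - K^-1) tensor K plus K^-1 tensor (K -
      K^-1) is K tensor K minus K^-1 tensor K^-1.\<close>
    have "ucls2 (free_tensor (\<B> * \<T>) \<K> + free_tensor \<B> (\<K> * \<T>) +
          (free_tensor (\<K>' * \<T>) \<B> + free_tensor \<K>' (\<B> * \<T>))) =
        ucls2 (free_tensor (\<T> * \<B> + ?d * (\<K> - \<K>')) \<K> + free_tensor \<B> (\<T> * \<K>) +
          (free_tensor (\<T> * \<K>') \<B> + free_tensor \<K>' (\<T> * \<B> + ?d * (\<K> - \<K>'))))"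
      by (intro cong uq_relations uq_Kinv_T refl)
    then show ?thesis
      unfolding 6 cls_eq_iff by (simp add: free_hom_simps free_tensor_mult free_tensor_linear algebra_simps)
  qed
qed

section \<open>The coproduct on cosets and Sweedler representations\<close>

lemma uq_coprod_cls: "uq_coprod w (ucls x) = ucls2 (free_hom const coprod_gen x)"
proof -
  interpret scalar_map "const :: complex \<Rightarrow> galilei_gen list \<times> galilei_gen list \<Rightarrow>\<^sub>0 complex"
    by (rule scalar_map_const)
  have "free_hom const coprod_gen r \<in> uideal2" if "r \<in> uideal" for r
    using that
  proof (induct r rule: genideal_induct)
    case (relator r)
    then show ?case by (rule coproduct_relator)
  next
    case zero
    show ?case by (simp add: genideal_0)
  next
    case (add x y)
    then show ?case by (simp only: free_hom_add genideal_add)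
  next
    case (mult_left a x)
    then show ?case by (simp only: free_hom_mult genideal_mult_left)
  next
    case (mult_right a x)
    then show ?case by (simp only: free_hom_mult genideal_mult_right)
  qed
  then show ?thesis
    unfolding uq_coprod_def by (rule Union_cls_image [OF free_hom_diff])
qed

text \<open>Choosing representatives turns a Sweedler decomposition into a congruence in the free
  tensor square, where linear maps can be evaluated term by term.\<close>

lemma sweedler_reps:
  assumes "sweedler w (ucls x) n P Q"
  obtains p q where "\<And>i. i < n \<Longrightarrow> P i = ucls (p i)" "\<And>i. i < n \<Longrightarrow> Q i = ucls (q i)"
    "free_hom const coprod_gen x - (\<Sum>i<n. free_tensor (p i) (q i)) \<in> uideal2"
proof -
  have "\<forall>i. \<exists>y. i < n \<longrightarrow> P i = ucls y" "\<forall>i. \<exists>y. i < n \<longrightarrow> Q i = ucls y"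
    using assms by (auto simp: sweedler_def image_iff)
  then obtain p q where pq: "\<And>i. i < n \<Longrightarrow> P i = ucls (p i)" "\<And>i. i < n \<Longrightarrow> Q i = ucls (q i)"
    by metis
  interpret Q: ring "Uq2 w" by (rule ring_presented_algebra)
  have "(\<Oplus>\<^bsub>Uq2 w\<^esub>i\<in>{..<n}. uq_tensor w (P i) (Q i)) = (\<Oplus>\<^bsub>Uq2 w\<^esub>i\<in>{..<n}. ucls2 (free_tensor (p i) (q i)))"
    by (rule Q.finsum_cong') (auto simp: pq uq_tensor_cls)
  with assms have "ucls2 (free_hom const coprod_gen x) = ucls2 (\<Sum>i<n. free_tensor (p i) (q i))"
    by (simp add: sweedler_def uq_coprod_cls cls_finsum)
  with pq show ?thesis by (intro that) (simp_all add: cls_eq_iff)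
qed

text \<open>The one explicit decomposition required: it is the test case that rules out essential
  invariance.\<close>

lemma sweedler_B:
  "sweedler w (uq_B w) 2 (\<lambda>i. if i = 0 then ucls \<B> else ucls \<K>') (\<lambda>i. if i = 0 then ucls \<K> else ucls \<B>)"
proof -
  interpret Q: ring "Uq2 w" by (rule ring_presented_algebra)
  interpret scalar_map "const :: complex \<Rightarrow> galilei_gen list \<times> galilei_gen list \<Rightarrow>\<^sub>0 complex"
    by (rule scalar_map_const)
  have "(\<Oplus>\<^bsub>Uq2 w\<^esub>i\<in>{..<2::nat}. uq_tensor w (if i = 0 then ucls \<B> else ucls \<K>') (if i = 0 then ucls \<K> else ucls \<B>)) =
     (\<Oplus>\<^bsub>Uq2 w\<^esub>i\<in>{..<2::nat}. ucls2 (if i = 0 then free_tensor \<B> \<K> else free_tensor \<K>' \<B>))"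
    by (rule Q.finsum_cong') (auto simp: uq_tensor_cls)
  also have "\<dots> = ucls2 (coprod_gen Gen_B)"
    by (simp add: cls_finsum eval_nat_numeral)
  finally show ?thesis
    by (simp add: sweedler_def uq_B_def uq_coprod_cls)
qed

subsection \<open>Well-definedness of the symbol and the counit\<close>

text \<open>In the commutative target M, T and K - K^-1 vanish and K is 1, which kills every
  relator.\<close>

lemma symbol_ideal: "r \<in> genideal monoid_algebra (uq_relators w) \<Longrightarrow> symbol r = 0"
proof (induct r rule: genideal_induct)
  case (relator r)
  then show ?case by (cases rule: uq_relator_cases) (simp_all add: symbol_simps)
qed (simp_all add: symbol_add symbol_mult)

lemma symbol_cong: "ucls x = ucls y \<Longrightarrow> symbol x = symbol y"
  using symbol_ideal [of "x - y"] by (simp add: cls_eq_iff symbol_diff)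

text \<open>The counit is the symbol evaluated at z = 0. The symbol is constant on a coset, so the
  image is a singleton, as \<open>the_elem\<close> requires.\<close>

lemma uq_counit_cls: "uq_counit (ucls x) = coeff (symbol x) 0"
proof -
  interpret scalar_map "id :: complex \<Rightarrow> complex" by (rule scalar_map_id)
  have counit: "free_hom id counit_gen y = coeff (symbol y) 0" for y
  proof (induct y rule: free_algebra_induct)
    case (gen g y)
    then show ?case
      by (cases g) (simp_all only: free_hom_mult free_hom_gen symbol_mult symbol_gen counit_gen.simps, simp_all)
  next
    case (scale c y)
    then show ?case by (simp only: free_hom_mult free_hom_const symbol_mult symbol_const) simp
  next
    case (add x y)
    then show ?case by (simp only: free_hom_add symbol_add coeff_add)
  qed (simp_all only: free_hom_0 free_hom_1 symbol_0 symbol_1, simp_all)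
  have "free_hom id counit_gen y = coeff (symbol x) 0" if "y \<in> ucls x" for y
    using symbol_cong [OF cls_eqI [OF that]] counit by simp
  moreover have "x \<in> ucls x" by simp
  ultimately have "free_hom id counit_gen ` ucls x = {coeff (symbol x) 0}"
    by (simp only: image_constant cong: image_cong)
  then show ?thesis by (simp add: uq_counit_def)
qed

subsection \<open>The spanning half of the Poincare-Birkhoff-Witt theorem\<close>

lemma uq_commute_power:
  assumes "ucls (x * y) = ucls (y * x)"
  shows "ucls (x * y ^ n) = ucls (y ^ n * x)"
proof (induct n)
  case (Suc n)
  have "ucls (x * y ^ Suc n) = ucls (x * y * y ^ n)" by (simp only: power_Suc mult.assoc)
  also have "\<dots> = ucls (y * x * y ^ n)" by (intro uq_cong_right assms)
  also have "\<dots> = ucls (y * (x * y ^ n))" by (simp only: mult.assoc)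
  also have "\<dots> = ucls (y * (y ^ n * x))" by (intro uq_cong_left Suc)
  also have "\<dots> = ucls (y ^ Suc n * x)" by (simp only: power_Suc mult.assoc)
  finally show ?case .
qed simp

lemma uq_commute_mult:
  assumes "ucls (x * y) = ucls (y * x)" "ucls (x * z) = ucls (z * x)"
  shows "ucls (x * (y * z)) = ucls (y * z * x)"
proof -
  have "ucls (x * (y * z)) = ucls (x * y * z)" by (simp only: mult.assoc)
  also have "\<dots> = ucls (y * x * z)" by (intro uq_cong_right assms)
  also have "\<dots> = ucls (y * (x * z))" by (simp only: mult.assoc)
  also have "\<dots> = ucls (y * (z * x))" by (intro uq_cong_left assms)
  finally show ?thesis by (simp only: mult.assoc)
qed

section \<open>Normal ordering of the generators other than B\<close>

definition uq_K_power :: "int \<Rightarrow> galilei_free" where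
  "uq_K_power l = (if l < 0 then \<K>' ^ nat (- l) else \<K> ^ nat l)"

text \<open>The factor I^\<alpha> K^l T^\<gamma> of a PBW monomial, with I represented by
  \<open>\<K>' * \<M>\<close>.\<close>

definition uq_torus_mono :: "nat \<Rightarrow> int \<Rightarrow> nat \<Rightarrow> galilei_free" where
  "uq_torus_mono \<alpha> l \<gamma> = (\<K>' * \<M>) ^ \<alpha> * uq_K_power l * \<T> ^ \<gamma>"

lemma uq_KKinv: "ucls (\<K> * \<K>') = ucls (\<K>' * \<K>)"
  by (simp add: uq_relations)

lemma uq_I_commute:
  assumes "ucls (x * \<K>') = ucls (\<K>' * x)"
  shows "ucls (x * (\<K>' * \<M>) ^ \<alpha>) = ucls ((\<K>' * \<M>) ^ \<alpha> * x)"
  by (intro uq_commute_power uq_commute_mult assms uq_M_central [symmetric])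

lemma uq_K_K_power: "ucls (\<K> * uq_K_power l) = ucls (uq_K_power (l + 1))"
proof (cases "l < 0")
  case True
  define n where "n = nat (- l - 1)"
  have "uq_K_power l = \<K>' * \<K>' ^ n" "uq_K_power (l + 1) = \<K>' ^ n"
    using True by (auto simp: uq_K_power_def n_def Suc_nat_eq_nat_zadd1 simp flip: power_Suc)
  then show ?thesis by (simp only: uq_cancel)
next
  case False
  then show ?thesis by (simp add: uq_K_power_def nat_add_distrib)
qed

lemma uq_Kinv_K_power: "ucls (\<K>' * uq_K_power l) = ucls (uq_K_power (l - 1))"
proof -
  have "ucls (\<K>' * uq_K_power l) = ucls (\<K>' * (\<K> * uq_K_power (l - 1)))"
    using uq_K_K_power [of "l - 1"] by (intro uq_cong_left) simp
  then show ?thesis by (simp only: uq_cancel)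
qed

lemma uq_left_torus_mono:
  assumes "ucls (x * \<K>') = ucls (\<K>' * x)" "ucls (x * uq_K_power l) = ucls (uq_K_power l')"
  shows "ucls (x * uq_torus_mono \<alpha> l \<gamma>) = ucls (uq_torus_mono \<alpha> l' \<gamma>)"
proof -
  have "ucls (x * uq_torus_mono \<alpha> l \<gamma>) = ucls (x * (\<K>' * \<M>) ^ \<alpha> * (uq_K_power l * \<T> ^ \<gamma>))"
    by (simp only: uq_torus_mono_def mult.assoc)
  also have "\<dots> = ucls ((\<K>' * \<M>) ^ \<alpha> * x * (uq_K_power l * \<T> ^ \<gamma>))"
    by (intro uq_cong_right uq_I_commute assms)
  also have "\<dots> = ucls ((\<K>' * \<M>) ^ \<alpha> * (x * uq_K_power l) * \<T> ^ \<gamma>)"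
    by (simp only: mult.assoc)
  also have "\<dots> = ucls (uq_torus_mono \<alpha> l' \<gamma>)"
    unfolding uq_torus_mono_def by (intro uq_cong_left uq_cong_right assms)
  finally show ?thesis .
qed

text \<open>K and K^-1 shift \<open>l\<close>, and T raises \<gamma> after commuting past the rest.
  Since M = I K, multiplying by M raises both \<alpha> and \<open>l\<close>.\<close>

lemma uq_gen_torus_mono:
  assumes "g \<noteq> Gen_B"
  shows "\<exists>\<alpha>' l' \<gamma>'. ucls (gen g * uq_torus_mono \<alpha> l \<gamma>) = ucls (uq_torus_mono \<alpha>' l' \<gamma>')"
proof (cases g)
  case Gen_K
  then show ?thesis using uq_left_torus_mono [OF uq_KKinv uq_K_K_power] by blast
next
  case Gen_Kinv
  then show ?thesis using uq_left_torus_mono [OF refl uq_Kinv_K_power] by blast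
next
  case Gen_M
  have "ucls (\<M> * uq_torus_mono \<alpha> l \<gamma>) = ucls (\<K>' * (\<K> * (\<M> * uq_torus_mono \<alpha> l \<gamma>)))"
    by (simp only: uq_cancel)
  also have "\<dots> = ucls (\<K>' * ((\<K> * \<M>) * uq_torus_mono \<alpha> l \<gamma>))"
    by (simp only: mult.assoc)
  also have "\<dots> = ucls (\<K>' * ((\<M> * \<K>) * uq_torus_mono \<alpha> l \<gamma>))"
    by (intro uq_cong_left uq_cong_right uq_M_central [symmetric])
  also have "\<dots> = ucls (\<K>' * \<M> * (\<K> * uq_torus_mono \<alpha> l \<gamma>))"
    by (simp only: mult.assoc)
  also have "\<dots> = ucls (\<K>' * \<M> * uq_torus_mono \<alpha> (l + 1) \<gamma>)"
    by (intro uq_cong_left uq_left_torus_mono uq_KKinv uq_K_K_power)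
  also have "\<dots> = ucls (uq_torus_mono (Suc \<alpha>) (l + 1) \<gamma>)"
    by (simp only: uq_torus_mono_def power_Suc mult.assoc)
  finally show ?thesis using Gen_M by blast
next
  case Gen_T
  have K: "ucls (\<T> * uq_K_power l) = ucls (uq_K_power l * \<T>)"
    unfolding uq_K_power_def
    by (simp add: uq_commute_power uq_relations(4) [symmetric] uq_Kinv_T [symmetric])
  have "ucls (\<T> * uq_torus_mono \<alpha> l \<gamma>) = ucls ((\<T> * ((\<K>' * \<M>) ^ \<alpha> * uq_K_power l)) * \<T> ^ \<gamma>)"
    by (simp only: uq_torus_mono_def mult.assoc)
  also have "\<dots> = ucls (((\<K>' * \<M>) ^ \<alpha> * uq_K_power l * \<T>) * \<T> ^ \<gamma>)"
    by (intro uq_cong_right uq_commute_mult uq_I_commute K uq_Kinv_T [symmetric])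
  also have "\<dots> = ucls (uq_torus_mono \<alpha> l (Suc \<gamma>))"
    by (simp only: uq_torus_mono_def power_Suc mult.assoc)
  finally show ?thesis using Gen_T by blast
qed (use assms in simp)

text \<open>The subalgebra generated by K, K^-1, M and T, up to congruence. Products are built by
  left multiplication with generators, so commutation claims are proved by induction without a
  normal form.\<close>

inductive uq_torus :: "galilei_free \<Rightarrow> bool" where
  one: "uq_torus 1"
| gen: "uq_torus x \<Longrightarrow> g \<noteq> Gen_B \<Longrightarrow> uq_torus (gen g * x)"
| scale: "uq_torus x \<Longrightarrow> uq_torus (const c * x)"
| add: "uq_torus x \<Longrightarrow> uq_torus y \<Longrightarrow> uq_torus (x + y)"
| cong: "uq_torus x \<Longrightarrow> ucls x = ucls y \<Longrightarrow> uq_torus y"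

inductive uq_torus_span :: "galilei_free \<Rightarrow> bool" where
  mono: "uq_torus_span (uq_torus_mono \<alpha> l \<gamma>)"
| scale: "uq_torus_span x \<Longrightarrow> uq_torus_span (const c * x)"
| add: "uq_torus_span x \<Longrightarrow> uq_torus_span y \<Longrightarrow> uq_torus_span (x + y)"
| cong: "uq_torus_span x \<Longrightarrow> ucls x = ucls y \<Longrightarrow> uq_torus_span y"

text \<open>Left polynomials in N = K B. The coefficients stay arbitrary elements of
  \<open>uq_torus\<close>, so they can absorb scalars and the commutators with B; they are expanded
  into monomials only in \<open>pbw_induct\<close>.\<close>

inductive uq_span :: "galilei_free \<Rightarrow> bool" where
  mono: "uq_torus x \<Longrightarrow> uq_span (x * (\<K> * \<B>) ^ \<delta>)"
| add: "uq_span x \<Longrightarrow> uq_span y \<Longrightarrow> uq_span (x + y)"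
| cong: "uq_span x \<Longrightarrow> ucls x = ucls y \<Longrightarrow> uq_span y"

lemma uq_torus_span_gen: "uq_torus_span x \<Longrightarrow> g \<noteq> Gen_B \<Longrightarrow> uq_torus_span (gen g * x)"
proof (induct rule: uq_torus_span.induct)
  case (mono \<alpha> l \<gamma>)
  then show ?case
    using uq_gen_torus_mono [of g \<alpha> l \<gamma>] uq_torus_span.cong [OF uq_torus_span.mono] by metis
next
  case (scale x c)
  then show ?case by (simp add: gen_const uq_torus_span.scale)
next
  case (add x y)
  then show ?case by (simp add: distrib_left uq_torus_span.add)
next
  case (cong x y)
  then show ?case using uq_cong_left uq_torus_span.cong by metis
qed

lemma uq_torus_imp_span: "uq_torus x \<Longrightarrow> uq_torus_span x"
proof (induct rule: uq_torus.induct)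
  case one
  show ?case using uq_torus_span.mono [of 0 0 0] by (simp add: uq_torus_mono_def uq_K_power_def)
qed (auto intro: uq_torus_span_gen uq_torus_span.intros)

lemma uq_torus_commute_K: "uq_torus x \<Longrightarrow> ucls (\<K> * x) = ucls (x * \<K>)"
proof (induct rule: uq_torus.induct)
  case (gen x g)
  have "ucls (\<K> * gen g) = ucls (gen g * \<K>)"
    using gen(3) uq_KKinv uq_relations(4) uq_M_central by (cases g) auto
  with gen(2) show ?case by (intro uq_commute_mult)
next
  case (scale x c)
  then show ?case using uq_cong_left [OF scale(2), of "const c"] by (simp add: gen_const mult.assoc)
next
  case (add x y)
  then show ?case unfolding distrib_left distrib_right by (intro cls_add_cong)
next
  case (cong x y)
  then show ?case using uq_cong_left uq_cong_right by metis
qed simp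

lemma uq_torus_minus: "uq_torus x \<Longrightarrow> uq_torus y \<Longrightarrow> uq_torus (x - y)"
  using uq_torus.add [of x "const (-1) * y"] uq_torus.scale [of y "-1"] by (simp add: const_uminus)

lemma uq_torus_0: "uq_torus 0"
  using uq_torus_minus [OF uq_torus.one uq_torus.one] by simp

text \<open>The commutators of B with K, K^-1, M and T are iw M K, -iw M K^-1, 0 and i (K -
  K^-1)/(2w), none of which involves B.\<close>

lemma uq_B_gen_commutator:
  assumes "uq_torus x" "g \<noteq> Gen_B"
  shows "uq_torus ((\<B> * gen g - gen g * \<B>) * x)"
proof (cases g)
  case Gen_K
  have "ucls ((\<B> * \<K> - (\<B> * \<K> - const (\<i> * of_real w) * (\<M> * \<K>))) * x) = ucls ((\<B> * \<K> - \<K> * \<B>) * x)"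
    by (intro uq_cong_right cls_diff_cong refl uq_K_B [symmetric])
  moreover have "uq_torus (const (\<i> * of_real w) * (\<M> * (\<K> * x)))"
    using assms by (auto intro!: uq_torus.scale uq_torus.gen)
  ultimately show ?thesis using Gen_K uq_torus.cong by (simp add: mult.assoc)
next
  case Gen_Kinv
  have "ucls ((\<B> * \<K>' - (\<B> * \<K>' + const (\<i> * of_real w) * (\<M> * \<K>'))) * x) = ucls ((\<B> * \<K>' - \<K>' * \<B>) * x)"
    by (intro uq_cong_right cls_diff_cong refl uq_Kinv_B [symmetric])
  moreover have "uq_torus (const (- (\<i> * of_real w)) * (\<M> * (\<K>' * x)))"
    using assms by (auto intro!: uq_torus.scale uq_torus.gen)
  ultimately show ?thesis using Gen_Kinv uq_torus.cong by (simp add: mult.assoc const_uminus)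
next
  case Gen_M
  have "ucls ((\<B> * \<M> - \<B> * \<M>) * x) = ucls ((\<B> * \<M> - \<M> * \<B>) * x)"
    by (intro uq_cong_right cls_diff_cong refl uq_M_central [symmetric])
  then show ?thesis using Gen_M uq_torus.cong [OF uq_torus_0] by simp
next
  case Gen_T
  have "ucls ((\<T> * \<B> + const (\<i> / (2 * of_real w)) * (\<K> - \<K>') - \<T> * \<B>) * x) = ucls ((\<B> * \<T> - \<T> * \<B>) * x)"
    by (intro uq_cong_right cls_diff_cong refl uq_relations(6) [symmetric])
  moreover have "uq_torus (const (\<i> / (2 * of_real w)) * (\<K> * x - \<K>' * x))"
    using assms by (auto intro!: uq_torus.scale uq_torus.gen uq_torus_minus)
  ultimately show ?thesis using Gen_T uq_torus.cong by (simp add: mult.assoc left_diff_distrib)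
qed (use assms in simp)

text \<open>Taking the commutator with B is a derivation, so its values on generators
  decide.\<close>

lemma uq_torus_commutator: "uq_torus x \<Longrightarrow> uq_torus (\<B> * x - x * \<B>)"
proof (induct rule: uq_torus.induct)
  case one
  show ?case using uq_torus_0 by simp
next
  case (gen x g)
  have "\<B> * (gen g * x) - gen g * x * \<B> = (\<B> * gen g - gen g * \<B>) * x + gen g * (\<B> * x - x * \<B>)"
    by (simp add: algebra_simps)
  with gen uq_B_gen_commutator show ?case by (simp add: uq_torus.add uq_torus.gen)
next
  case (scale x c)
  have "\<B> * (const c * x) - const c * x * \<B> = const c * (\<B> * x - x * \<B>)"
    by (simp add: gen_const algebra_simps)
  with scale show ?case by (simp add: uq_torus.scale)
next
  case (add x y)
  have "\<B> * (x + y) - (x + y) * \<B> = (\<B> * x - x * \<B>) + (\<B> * y - y * \<B>)"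
    by (simp add: algebra_simps)
  with add show ?case by (simp add: uq_torus.add)
next
  case (cong x y)
  have "ucls (\<B> * x - x * \<B>) = ucls (\<B> * y - y * \<B>)"
    by (intro cls_diff_cong uq_cong_left uq_cong_right cong)
  with cong show ?case using uq_torus.cong by blast
qed

text \<open>Only multiplication by B is not immediate. There B x = [B,x] + x B, where the commutator
  is again a coefficient, and x B = K^-1 x K B = (K^-1 x) N because K commutes with x; so the second
  part gains one power of N.\<close>

lemma uq_span_gen: "uq_span x \<Longrightarrow> uq_span (gen g * x)"
proof (induct rule: uq_span.induct)
  case (mono x \<delta>)
  show ?case
  proof (cases "g = Gen_B")
    case True
    let ?N = "\<K> * \<B>"
    have "ucls (x * \<B>) = ucls (\<K>' * (\<K> * x) * \<B>)"
      by (intro uq_cong_right) (simp only: uq_cancel)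
    also have "\<dots> = ucls (\<K>' * (x * \<K>) * \<B>)"
      by (intro uq_cong_right uq_cong_left uq_torus_commute_K mono)
    finally have "ucls (x * \<B> * ?N ^ \<delta>) = ucls (\<K>' * (x * \<K>) * \<B> * ?N ^ \<delta>)"
      by (rule uq_cong_right)
    then have "ucls ((\<B> * x - x * \<B>) * ?N ^ \<delta> + \<K>' * x * ?N ^ Suc \<delta>) =
        ucls ((\<B> * x - x * \<B>) * ?N ^ \<delta> + x * \<B> * ?N ^ \<delta>)"
      by (intro cls_add_cong refl) (simp only: power_Suc mult.assoc)
    moreover have "uq_span ((\<B> * x - x * \<B>) * ?N ^ \<delta> + \<K>' * x * ?N ^ Suc \<delta>)"
      by (intro uq_span.add uq_span.mono uq_torus_commutator uq_torus.gen mono) simp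
    moreover have "(\<B> * x - x * \<B>) * ?N ^ \<delta> + x * \<B> * ?N ^ \<delta> = gen g * (x * ?N ^ \<delta>)"
      by (simp only: True left_diff_distrib mult.assoc) simp
    ultimately show ?thesis using uq_span.cong by metis
  next
    case False
    then show ?thesis using uq_span.mono [OF uq_torus.gen [OF mono False], of \<delta>] by (simp only: mult.assoc)
  qed
next
  case (add x y)
  then show ?case by (simp only: distrib_left uq_span.add)
next
  case (cong x y)
  then show ?case using uq_cong_left uq_span.cong by metis
qed

lemma uq_span_scale: "uq_span x \<Longrightarrow> uq_span (const c * x)"
proof (induct rule: uq_span.induct)
  case (mono x \<delta>)
  then show ?case using uq_span.mono [OF uq_torus.scale [OF mono], of c \<delta>] by (simp only: mult.assoc)
next
  case (add x y)
  then show ?case by (simp only: distrib_left uq_span.add)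
next
  case (cong x y)
  then show ?case using uq_cong_left uq_span.cong by metis
qed

lemma uq_span_all: "uq_span x"
proof (induct x rule: free_algebra_induct)
  case zero
  show ?case using uq_span.mono [OF uq_torus_0, of 0] by simp
next
  case one
  show ?case using uq_span.mono [OF uq_torus.one, of 0] by simp
qed (auto intro: uq_span_gen uq_span_scale uq_span.add)

text \<open>First the coefficients of powers of N are expanded into monomials, then sums of such
  terms are formed; \<open>uq_span_all\<close> says that nothing else occurs.\<close>

lemma pbw_induct [case_names mono scale add cong]:
  assumes mono: "\<And>\<alpha> l \<gamma> \<delta>. P (uq_torus_mono \<alpha> l \<gamma> * (\<K> * \<B>) ^ \<delta>)"
    and scale: "\<And>c x. P x \<Longrightarrow> P (const c * x)"
    and add: "\<And>x y. P x \<Longrightarrow> P y \<Longrightarrow> P (x + y)"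
    and cong: "\<And>x y. P x \<Longrightarrow> ucls x = ucls y \<Longrightarrow> P y"
  shows "P x"
proof -
  have *: "P (x * (\<K> * \<B>) ^ \<delta>)" if "uq_torus_span x" for x \<delta>
    using that
  proof (induct rule: uq_torus_span.induct)
    case (mono \<alpha> l \<gamma>)
    show ?case by (rule assms(1))
  next
    case (scale x c)
    then show ?case using assms(2) [OF scale(2), of c] by (simp only: mult.assoc)
  next
    case (add x y)
    then show ?case using assms(3) by (simp only: distrib_right)
  next
    case (cong x y)
    then show ?case using assms(4) uq_cong_right by metis
  qed
  show ?thesis using uq_span_all [of x]
  proof (induct rule: uq_span.induct)
    case (mono x \<delta>)
    then show ?case by (intro * uq_torus_imp_span)
  qed (blast intro: add cong)+
qed

text \<open>Both sides are linear and constant on cosets, so PBW monomials suffice: the symbol kills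
  I and T and sends K to 1 and N to z, which matches the prescribed values.\<close>

lemma v_pairing_symbol:
  assumes "is_v_pairing w pairing"
  shows "pairing n (ucls x) = \<i> ^ n * fact n * coeff (symbol x) n"
proof (induct x rule: pbw_induct)
  case (mono \<alpha> l \<gamma> \<delta>)
  have I: "uq_I w = ucls (\<K>' * \<M>)" and K: "uq_K w [^]\<^bsub>Uq w\<^esub> l = ucls (uq_K_power l)"
    using cls_inv [OF uq_relations(2,3)] cls_int_pow [OF uq_relations(2,3), where l = l]
    by (simp_all add: uq_I_def uq_K_def uq_M_def uq_K_power_def)
  have "pairing n (uq_I w [^]\<^bsub>Uq w\<^esub> \<alpha> \<otimes>\<^bsub>Uq w\<^esub> uq_K w [^]\<^bsub>Uq w\<^esub> l \<otimes>\<^bsub>Uq w\<^esub> uq_T w [^]\<^bsub>Uq w\<^esub> \<gamma>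
      \<otimes>\<^bsub>Uq w\<^esub> uq_N w [^]\<^bsub>Uq w\<^esub> \<delta>) = (if \<alpha> = 0 \<and> \<gamma> = 0 \<and> \<delta> = n then \<i> ^ n * fact n else 0)"
    using assms by (simp add: is_v_pairing_def)
  then have "pairing n (ucls (uq_torus_mono \<alpha> l \<gamma> * (\<K> * \<B>) ^ \<delta>)) =
      (if \<alpha> = 0 \<and> \<gamma> = 0 \<and> \<delta> = n then \<i> ^ n * fact n else 0)"
    unfolding I K by (simp add: uq_N_def uq_K_def uq_B_def uq_T_def cls_pow uq_torus_mono_def)
  moreover have "symbol (uq_torus_mono \<alpha> l \<gamma> * (\<K> * \<B>) ^ \<delta>) =
      (if \<alpha> = 0 \<and> \<gamma> = 0 then monom 1 \<delta> else 0)"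
    by (simp add: uq_torus_mono_def uq_K_power_def symbol_mult symbol_power monom_altdef)
  ultimately show ?case by simp
next
  case (scale c x)
  have "pairing n (c \<odot>\<^bsub>Uq w\<^esub> ucls x) = c * pairing n (ucls x)"
    using assms unfolding is_v_pairing_def linear_functional_def by auto
  with scale show ?case by (simp add: symbol_mult)
next
  case (add x y)
  have "pairing n (ucls x \<oplus>\<^bsub>Uq w\<^esub> ucls y) = pairing n (ucls x) + pairing n (ucls y)"
    using assms unfolding is_v_pairing_def linear_functional_def by auto
  with add show ?case by (simp add: symbol_add distrib_left)
next
  case (cong x y)
  then show ?case using symbol_cong by metis
qed

end

subsection \<open>Bilinear expressions in Sweedler components\<close>

text \<open>The linear map on the free tensor square that sends X tensor Y to p(E) a times q(F) b,
  where p and q are the symbols of X and Y. A Sweedler sum of this shape becomes the value of one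
  linear map.\<close>

definition tensor_op ::
    "(laurent \<Rightarrow> laurent) \<Rightarrow> (laurent \<Rightarrow> laurent) \<Rightarrow> laurent \<Rightarrow> laurent \<Rightarrow>
     (galilei_gen list \<times> galilei_gen list \<Rightarrow>\<^sub>0 complex) \<Rightarrow> laurent" where
  "tensor_op E F a b = lin_ext const (\<lambda>(u, v).
     poly_op E (symbol (Poly_Mapping.single u 1)) a * poly_op F (symbol (Poly_Mapping.single v 1)) b)"

lemma tensor_op_add: "tensor_op E F a b (s + t) = tensor_op E F a b s + tensor_op E F a b t"
  and tensor_op_scale: "tensor_op E F a b (const c * t) = const c * tensor_op E F a b t"
  and tensor_op_0 [simp]: "tensor_op E F a b 0 = 0"
  by (simp_all add: tensor_op_def lin_ext_const_add lin_ext_const_scale)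

lemma tensor_op_diff: "tensor_op E F a b (s - t) = tensor_op E F a b s - tensor_op E F a b t"
  using tensor_op_add [of E F a b s "- t"] tensor_op_scale [of E F a b "-1" t]
  by (simp add: const_uminus)

lemma tensor_op_sum: "finite A \<Longrightarrow> tensor_op E F a b (sum t A) = (\<Sum>i\<in>A. tensor_op E F a b (t i))"
  by (induct rule: finite_induct) (simp_all add: tensor_op_add)

context
  fixes E F :: "laurent \<Rightarrow> laurent"
  assumes E: "linear_op E" and F: "linear_op F"
begin

lemma tensor_op_zero: "tensor_op E F 0 b t = 0" "tensor_op E F a 0 t = 0"
  by (simp_all add: tensor_op_def lin_ext_def split_beta linear_op_0 linear_op_poly_op E F)

lemma tensor_op_free_tensor:
  "tensor_op E F a b (free_tensor p q) = poly_op E (symbol p) a * poly_op F (symbol q) b"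
proof (induct p rule: poly_mapping_sum_induct)
  case (single u c)
  show ?case
  proof (induct q rule: poly_mapping_sum_induct)
    case (single v d)
    have "symbol (Poly_Mapping.single u c) = smult c (symbol (Poly_Mapping.single u 1))"
      "symbol (Poly_Mapping.single v d) = smult d (symbol (Poly_Mapping.single v 1))"
      by (subst single_eq_const, simp add: symbol_mult)+
    then show ?case
      by (simp add: free_tensor_single tensor_op_def lin_ext_const_single poly_op_smult E F const_mult mult_ac)
  qed (simp_all add: free_tensor_add_right tensor_op_add symbol_add poly_op_add F distrib_left)
qed (simp_all add: free_tensor_add_left tensor_op_add symbol_add poly_op_add E distrib_right)

lemma single_pair: "Poly_Mapping.single (u, v) c =
    const c * free_tensor (Poly_Mapping.single u 1) (Poly_Mapping.single v 1)"
  by (simp add: free_tensor_single flip: single_eq_const)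

text \<open>Symbols multiply and commute, so the operators of the extra factor may be applied to
  \<open>a\<close> and \<open>b\<close> first.\<close>

lemma tensor_op_mult_left:
  "tensor_op E F a b (free_tensor p q * t) = tensor_op E F (poly_op E (symbol p) a) (poly_op F (symbol q) b) t"
proof (induct t rule: poly_mapping_sum_induct)
  case (single k c)
  obtain u v where k: "k = (u, v)" by (cases k)
  have "symbol p * symbol x = symbol x * symbol p" "symbol q * symbol x = symbol x * symbol q" for x
    by (simp_all add: mult.commute)
  then show ?case
    unfolding k single_pair const_left_commute [of "free_tensor p q"]
    by (simp only: free_tensor_mult tensor_op_scale tensor_op_free_tensor symbol_mult
        poly_op_mult [OF E] poly_op_mult [OF F])
qed (simp_all add: distrib_left tensor_op_add)

lemma tensor_op_mult_right: "tensor_op E F a b (t * free_tensor p q) = tensor_op E F a b (free_tensor p q * t)"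
proof (induct t rule: poly_mapping_sum_induct)
  case (single k c)
  obtain u v where k: "k = (u, v)" by (cases k)
  have "symbol p * symbol x = symbol x * symbol p" "symbol q * symbol x = symbol x * symbol q" for x
    by (simp_all add: mult.commute)
  then show ?case
    unfolding k single_pair const_left_commute [of "free_tensor p q"] mult.assoc
    by (simp only: free_tensor_mult tensor_op_scale tensor_op_free_tensor symbol_mult)
qed (simp_all add: distrib_left distrib_right tensor_op_add)

text \<open>The image of the symbol map is commutative, so multiplying by a tensor on either side only
  changes \<open>a\<close> and \<open>b\<close>; therefore the claim for all \<open>a\<close>, \<open>b\<close> passes to the ideal.\<close>

lemma tensor_op_ideal:
  assumes "r \<in> genideal monoid_algebra (uq2_relators w)"
  shows "tensor_op E F a b r = 0"
proof -
  have "\<forall>a b. tensor_op E F a b r = 0"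
    using assms
  proof (induct r rule: genideal_induct)
    case (relator r)
    then obtain s where "s \<in> uq_relators w" and r: "r = free_tensor s 1 \<or> r = free_tensor 1 s"
      by (auto simp: uq2_relators_def)
    then have "symbol s = 0" using symbol_ideal genideal_relator by blast
    with r show ?case by (auto simp: tensor_op_free_tensor)
  next
    case (mult_left s x)
    have "\<forall>a b. tensor_op E F a b (s * x) = 0"
    proof (induct s rule: poly_mapping_sum_induct)
      case (single k c)
      show ?case using mult_left
        by (cases k) (simp add: single_pair mult.assoc tensor_op_scale tensor_op_mult_left)
    qed (simp_all add: distrib_right tensor_op_add)
    then show ?case .
  next
    case (mult_right s x)
    have "\<forall>a b. tensor_op E F a b (x * s) = 0"
    proof (induct s rule: poly_mapping_sum_induct)
      case (single k c)
      show ?case using mult_right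
        by (cases k)
          (simp add: single_pair const_left_commute [of x] tensor_op_scale tensor_op_mult_right tensor_op_mult_left)
    qed (simp_all add: distrib_left tensor_op_add)
    then show ?case .
  qed (simp_all add: tensor_op_add)
  then show ?thesis by blast
qed

text \<open>K acts as 1 while M and T act as 0, so only B contributes: its coproduct becomes
  \<open>E\<close> on the first factor plus \<open>F\<close> on the second, which is
  \<open>G\<close> on the product. The induction keeps \<open>a\<close> and \<open>b\<close>
  arbitrary because each letter changes them.\<close>

lemma tensor_op_coproduct:
  assumes G: "linear_op G" and leibniz: "\<And>a b. G (a * b) = E a * b + a * F b"
  shows "tensor_op E F a b (free_hom const coprod_gen x) = poly_op G (symbol x) (a * b)"
proof -
  interpret scalar_map "const :: complex \<Rightarrow> galilei_gen list \<times> galilei_gen list \<Rightarrow>\<^sub>0 complex"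
    by (rule scalar_map_const)
  have "\<forall>a b. tensor_op E F a b (free_hom const coprod_gen x) = poly_op G (symbol x) (a * b)"
  proof (induct x rule: free_algebra_induct)
    case one
    have "tensor_op E F a b 1 = a * b" for a b
      using tensor_op_free_tensor [of a b 1 1] by (simp add: poly_op_1 E F)
    then show ?case by (simp add: poly_op_1 G)
  next
    case (gen g x)
    have B: "symbol (gen Gen_B * x) = pCons 0 (symbol x)" by (simp add: symbol_mult)
    show ?case
    proof (cases g)
      case Gen_B
      \<comment> \<open>The new letter acts innermost here, but outermost in the Horner scheme;
        \<open>poly_op_commute\<close> reconciles the two.\<close>
      have "poly_op G (symbol x) (E a * b) + poly_op G (symbol x) (a * F b) =
          G (poly_op G (symbol x) (a * b))" for a b
        by (simp only: poly_op_commute [OF G, symmetric] leibniz linear_op_add [OF linear_op_poly_op [OF G]])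
      then show ?thesis
        unfolding Gen_B B using gen
        by (simp add: free_hom_mult distrib_right tensor_op_add tensor_op_mult_left poly_op_pCons
            poly_op_1 linear_op_0 E F G)
    qed (use gen in \<open>simp_all add: free_hom_mult symbol_mult distrib_right tensor_op_add
        tensor_op_mult_left poly_op_1 E F G tensor_op_zero linear_op_0 linear_op_poly_op\<close>)
  next
    case (scale c x)
    then show ?case by (simp add: free_hom_mult tensor_op_scale symbol_mult poly_op_smult G)
  next
    case (add x y)
    then show ?case by (simp add: free_hom_add tensor_op_add symbol_add poly_op_add G)
  qed simp
  then show ?thesis by blast
qed

text \<open>The representatives are fixed before \<open>a\<close> and \<open>b\<close>, so each
  application can specialise these freely.\<close>

lemma sweedler_sum:
  assumes "linear_op G" "\<And>a b. G (a * b) = E a * b + a * F b"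
    and "sweedler w (cls (uq_relators w) x) n P Q"
  obtains p q where "\<And>i. i < n \<Longrightarrow> P i = cls (uq_relators w) (p i)"
    "\<And>i. i < n \<Longrightarrow> Q i = cls (uq_relators w) (q i)"
    "\<And>a b. (\<Sum>i<n. poly_op E (symbol (p i)) a * poly_op F (symbol (q i)) b) = poly_op G (symbol x) (a * b)"
proof -
  obtain p q where pq: "\<And>i. i < n \<Longrightarrow> P i = cls (uq_relators w) (p i)"
    "\<And>i. i < n \<Longrightarrow> Q i = cls (uq_relators w) (q i)"
    and ideal: "free_hom const coprod_gen x - (\<Sum>i<n. free_tensor (p i) (q i)) \<in> genideal monoid_algebra (uq2_relators w)"
    using sweedler_reps [OF assms(3)] by blast
  have "tensor_op E F a b (\<Sum>i<n. free_tensor (p i) (q i)) = poly_op G (symbol x) (a * b)" for a b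
    using tensor_op_ideal [OF ideal, of a b] tensor_op_coproduct [OF assms(1,2), of a b x]
    by (simp add: tensor_op_diff)
  then show ?thesis using pq by (intro that) (simp_all add: tensor_op_sum tensor_op_free_tensor)
qed

end

section \<open>The quasi-invariant functional\<close>

locale galilei_h0_action =
  fixes w m :: real
    and act :: "galilei_free set \<Rightarrow> h0_free set \<Rightarrow> h0_free set"
    and \<nu> :: "h0_free set \<Rightarrow> complex"
    and pairing :: "nat \<Rightarrow> galilei_free set \<Rightarrow> complex"
    and \<phi> :: "galilei_free set \<Rightarrow> h0_free set"
  assumes w_nonzero: "w \<noteq> 0" and m_nonzero: "m \<noteq> 0"
    and module: "module_star_algebra w m act"
    and act_B_chi: "\<And>l::int. act (uq_B w) (chi w m [^]\<^bsub>H0 w m\<^esub> l) =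
           (\<i> * of_real (w * m) * of_int l) \<odot>\<^bsub>H0 w m\<^esub> (chi w m [^]\<^bsub>H0 w m\<^esub> (l + 1))"
    and act_K: "\<And>f. f \<in> carrier (H0 w m) \<Longrightarrow> act (uq_K w) f = f"
    and act_T: "\<And>f. f \<in> carrier (H0 w m) \<Longrightarrow> act (uq_T w) f = \<zero>\<^bsub>H0 w m\<^esub>"
    and act_M: "\<And>f. f \<in> carrier (H0 w m) \<Longrightarrow> act (uq_M w) f = \<zero>\<^bsub>H0 w m\<^esub>"
    and nu_linear: "linear_functional (H0 w m) \<nu>"
    and nu_chi: "\<And>l::int. \<nu> (chi w m [^]\<^bsub>H0 w m\<^esub> l) = (if l = 0 then 1 else 0)"
    and pairing: "is_v_pairing w pairing"
    and phi: "\<And>X. X \<in> carrier (Uq w) \<Longrightarrow>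
           \<phi> X = uq_counit X \<odot>\<^bsub>H0 w m\<^esub> \<one>\<^bsub>H0 w m\<^esub> \<oplus>\<^bsub>H0 w m\<^esub>
             (\<Oplus>\<^bsub>H0 w m\<^esub>n\<in>{n. n \<ge> 1 \<and> pairing n X \<noteq> 0}.
                (of_real ((w * m / 2) ^ n * real (\<Prod>k=1..n. 2 * k - 1) / fact n) * pairing n X)
                \<odot>\<^bsub>H0 w m\<^esub> (chi w m [^]\<^bsub>H0 w m\<^esub> n))"
begin

abbreviation (input) "hof \<equiv> h0_of w m"

definition \<kappa> :: complex where "\<kappa> = \<i> * of_real (w * m)"

lemma kappa_nonzero: "\<kappa> \<noteq> 0" and cnj_kappa: "cnj \<kappa> = - \<kappa>"
  using w_nonzero m_nonzero by (simp_all add: \<kappa>_def)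

text \<open>The operators \<open>D\<close>, \<open>D'\<close> and \<open>- D - iwm \<chi>\<close> of the introduction are \<open>deriv \<kappa>\<close>, \<open>twist\<close>
  and \<open>coderiv\<close>.\<close>

definition twist :: "laurent \<Rightarrow> laurent" where
  "twist f = deriv \<kappa> f + Poly_Mapping.single 1 (\<kappa> / 2) * f"

definition coderiv :: "laurent \<Rightarrow> laurent" where
  "coderiv f = - deriv \<kappa> f - Poly_Mapping.single 1 \<kappa> * f"

lemma linear_op_deriv: "linear_op (deriv \<kappa>)"
  by (rule linear_opI) (simp_all add: deriv_add deriv_scale)

lemma linear_op_twist: "linear_op twist"
  by (rule linear_opI; unfold twist_def deriv_add deriv_scale; simp add: algebra_simps)

lemma linear_op_minus_twist: "linear_op (\<lambda>f. - twist f)"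
  by (rule linear_opI; unfold twist_def deriv_add deriv_scale; simp add: algebra_simps)

lemma linear_op_coderiv: "linear_op coderiv"
  by (rule linear_opI; unfold coderiv_def deriv_add deriv_scale; simp add: algebra_simps)

lemma twist_mult: "twist (a * b) = deriv \<kappa> a * b + a * twist b"
  by (simp add: twist_def deriv_mult algebra_simps)

lemma coderiv_mult: "coderiv (a * b) = - twist a * b + a * - twist b"
proof -
  \<comment> \<open>The term \<kappa> \<chi> is shared equally between the two factors.\<close>
  have "Poly_Mapping.single 1 \<kappa> = Poly_Mapping.single 1 (\<kappa> / 2) + Poly_Mapping.single (1 :: int) (\<kappa> / 2)"
    by (simp flip: single_add)
  then show ?thesis by (simp add: twist_def coderiv_def deriv_mult algebra_simps)
qed

lemma nu_hof: "\<nu> (hof f) = Poly_Mapping.lookup f 0"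
  by (rule functional_h0_of [OF nu_linear nu_chi])

lemma carrier_hof: "carrier (H0 w m) = range hof"
  by (rule carrier_H0 [OF w_nonzero m_nonzero])

subsection \<open>The action\<close>

lemma act_closed: "X \<in> carrier (Uq w) \<Longrightarrow> a \<in> carrier (H0 w m) \<Longrightarrow> act X a \<in> carrier (H0 w m)"
  and act_add_right: "X \<in> carrier (Uq w) \<Longrightarrow> a \<in> carrier (H0 w m) \<Longrightarrow> b \<in> carrier (H0 w m) \<Longrightarrow>
    act X (a \<oplus>\<^bsub>H0 w m\<^esub> b) = act X a \<oplus>\<^bsub>H0 w m\<^esub> act X b"
  and act_scale_right: "X \<in> carrier (Uq w) \<Longrightarrow> a \<in> carrier (H0 w m) \<Longrightarrow>
    act X (c \<odot>\<^bsub>H0 w m\<^esub> a) = c \<odot>\<^bsub>H0 w m\<^esub> act X a"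
  and act_add_left: "X \<in> carrier (Uq w) \<Longrightarrow> Y \<in> carrier (Uq w) \<Longrightarrow> a \<in> carrier (H0 w m) \<Longrightarrow>
    act (X \<oplus>\<^bsub>Uq w\<^esub> Y) a = act X a \<oplus>\<^bsub>H0 w m\<^esub> act Y a"
  and act_scale_left: "X \<in> carrier (Uq w) \<Longrightarrow> a \<in> carrier (H0 w m) \<Longrightarrow>
    act (c \<odot>\<^bsub>Uq w\<^esub> X) a = c \<odot>\<^bsub>H0 w m\<^esub> act X a"
  and act_mult: "X \<in> carrier (Uq w) \<Longrightarrow> Y \<in> carrier (Uq w) \<Longrightarrow> a \<in> carrier (H0 w m) \<Longrightarrow>
    act (X \<otimes>\<^bsub>Uq w\<^esub> Y) a = act X (act Y a)"
  and act_one: "a \<in> carrier (H0 w m) \<Longrightarrow> act \<one>\<^bsub>Uq w\<^esub> a = a"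
  using module by (simp_all add: module_star_algebra_def clinear_def Pi_iff del: presented_algebra_simps)

lemma act_B: "act (ucls w (gen Gen_B)) (hof f) = hof (deriv \<kappa> f)"
proof (induct f rule: poly_mapping_sum_induct)
  case zero
  \<comment> \<open>\<open>clinear\<close> does not mention zero; the value there follows from
    scaling by 0.\<close>
  have "act (ucls w (gen Gen_B)) (0 \<odot>\<^bsub>H0 w m\<^esub> hof 0) = 0 \<odot>\<^bsub>H0 w m\<^esub> act (ucls w (gen Gen_B)) (hof 0)"
    by (rule act_scale_right) simp_all
  moreover obtain g where "act (ucls w (gen Gen_B)) (hof 0) = hof g"
    using act_closed [of "ucls w (gen Gen_B)" "hof 0"] carrier_hof by auto
  ultimately show ?case by (simp add: h0_of_scale)
next
  case (single l c)
  have "act (ucls w (gen Gen_B)) (hof (Poly_Mapping.single l c)) =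
      c \<odot>\<^bsub>H0 w m\<^esub> act (ucls w (gen Gen_B)) (hof (Poly_Mapping.single l 1))"
    by (subst act_scale_right [symmetric]) (simp_all add: h0_of_scale flip: single_eq_const)
  also have "\<dots> = hof (deriv \<kappa> (Poly_Mapping.single l c))"
    using act_B_chi [of l]
    by (simp add: uq_B_def chi_int_pow_h0_of h0_of_scale deriv_single \<kappa>_def)
      (simp add: const_def mult_single mult_ac)
  finally show ?case .
next
  case (add f g)
  then show ?case using act_add_right [of "ucls w (gen Gen_B)" "hof f" "hof g"]
    by (simp add: h0_of_add deriv_add)
qed

lemma act_hof: "act (ucls w x) (hof f) = hof (poly_op (deriv \<kappa>) (symbol x) f)"
proof -
  have "\<forall>f. act (ucls w x) (hof f) = hof (poly_op (deriv \<kappa>) (symbol x) f)"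
  proof (induct x rule: free_algebra_induct)
    case zero
    show ?case
    proof
      fix f
      have "act (0 \<odot>\<^bsub>Uq w\<^esub> ucls w 0) (hof f) = 0 \<odot>\<^bsub>H0 w m\<^esub> act (ucls w 0) (hof f)"
        by (rule act_scale_left) simp_all
      moreover obtain g where "act (ucls w 0) (hof f) = hof g"
        using act_closed [of "ucls w 0" "hof f"] carrier_hof by auto
      ultimately show "act (ucls w 0) (hof f) = hof (poly_op (deriv \<kappa>) (symbol 0) f)"
        by (simp add: h0_of_scale)
    qed
  next
    case one
    show ?case using act_one [of "hof _"]
      by (simp add: poly_op_1 linear_op_deriv)
  next
    case (gen g x)
    have prod: "act (ucls w (gen g * x)) (hof f) = act (ucls w (gen g)) (hof (poly_op (deriv \<kappa>) (symbol x) f))" for f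
      using act_mult [of "ucls w (gen g)" "ucls w x" "hof f"] gen by simp
    \<comment> \<open>The action of K^-1 is not prescribed; it follows from that of K and K^-1 K =
      1.\<close>
    have Kinv: "act (ucls w (gen Gen_Kinv)) (hof f) = hof f" for f
    proof -
      have "act (ucls w (gen Gen_Kinv)) (hof f) = act (ucls w (gen Gen_Kinv)) (act (ucls w (gen Gen_K)) (hof f))"
        using act_K [of "hof f"] by (simp add: uq_K_def)
      also have "\<dots> = act (ucls w (gen Gen_Kinv * gen Gen_K)) (hof f)"
        using act_mult [of "ucls w (gen Gen_Kinv)" "ucls w (gen Gen_K)" "hof f"] by simp
      also have "\<dots> = act (ucls w 1) (hof f)" by (simp only: uq_relations)
      also have "\<dots> = hof f" using act_one [of "hof f"] by simp
      finally show ?thesis .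
    qed
    have B: "symbol (gen Gen_B * x) = pCons 0 (symbol x)" by (simp add: symbol_mult)
    show ?case
    proof (cases g)
      case Gen_K
      then show ?thesis using act_K prod by (simp add: uq_K_def symbol_mult)
    next
      case Gen_Kinv
      then show ?thesis using Kinv prod by (simp add: symbol_mult)
    next
      case Gen_B
      then show ?thesis using act_B prod by (simp add: B poly_op_pCons linear_op_deriv)
    next
      case Gen_M
      then show ?thesis using act_M prod by (simp add: uq_M_def symbol_mult h0_of_0 [simplified])
    next
      case Gen_T
      then show ?thesis using act_T prod by (simp add: uq_T_def symbol_mult h0_of_0 [simplified])
    qed
  next
    case (scale c x)
    then show ?case using act_scale_left [of "ucls w x" "hof _" c]
      by (simp add: h0_of_scale symbol_mult poly_op_smult linear_op_deriv)
  next
    case (add x y)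
    then show ?case using act_add_left [of "ucls w x" "ucls w y" "hof _"]
      by (simp add: h0_of_add symbol_add poly_op_add linear_op_deriv)
  qed
  then show ?thesis by blast
qed

subsection \<open>The weight\<close>

text \<open>\<open>twist\<close> sends \<chi>^l to (\<kappa>/2)(2l+1) \<chi>^(l+1), so the odd
  numbers accumulate to the double factorial.\<close>

lemma twist_power: "(twist ^^ n) 1 =
    Poly_Mapping.single (int n) (\<i> ^ n * of_real ((w * m / 2) ^ n * real (\<Prod>k=1..n. 2 * k - 1)))"
proof (induct n)
  case (Suc n)
  have twist_single: "twist (Poly_Mapping.single l c) = Poly_Mapping.single (l + 1) (\<kappa> / 2 * of_int (2 * l + 1) * c)" for l c
    by (simp add: twist_def deriv_single mult_single add.commute algebra_simps flip: single_add)
  have "(\<Prod>k=1..Suc n. 2 * k - 1) = (\<Prod>k=1..n. 2 * k - 1) * (2 * n + 1)"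
    by simp
  then have "\<kappa> / 2 * of_int (2 * int n + 1) * (\<i> ^ n * of_real ((w * m / 2) ^ n * real (\<Prod>k=1..n. 2 * k - 1))) =
      \<i> ^ Suc n * of_real ((w * m / 2) ^ Suc n * real (\<Prod>k=1..Suc n. 2 * k - 1))"
    by (simp only: of_nat_mult) (simp add: \<kappa>_def)
  then show ?case by (simp only: funpow.simps o_apply Suc twist_single) (simp add: add.commute)
qed simp

text \<open>The n! in the pairing cancels the one in c_n, leaving the coefficient of z^n times the
  n-th power of \<open>twist\<close> applied to 1. The counit supplies the term n = 0.\<close>

lemma phi_cls: "\<phi> (ucls w x) = hof (poly_op twist (symbol x) 1)"
proof -
  define p where "p = symbol x"
  define d :: "nat \<Rightarrow> complex" where "d n = of_real ((w * m / 2) ^ n * real (\<Prod>k=1..n. 2 * k - 1))" for n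
  define t :: "nat \<Rightarrow> laurent" where "t n = Poly_Mapping.single (int n) (coeff p n * (\<i> ^ n * d n))" for n
  have pairing_x: "pairing n (ucls w x) = \<i> ^ n * fact n * coeff p n" for n
    unfolding p_def by (rule v_pairing_symbol [OF pairing])
  let ?S = "{n. n \<ge> 1 \<and> pairing n (ucls w x) \<noteq> 0}"
  have S: "?S = {n. n \<ge> 1 \<and> coeff p n \<noteq> 0}" by (simp add: pairing_x)
  \<comment> \<open>Coefficients vanish beyond the degree; this finiteness gives the
    \<open>finsum\<close> in the definition of \<phi> its meaning.\<close>
  have S_sub: "?S \<subseteq> {..degree p}" unfolding S using le_degree by auto
  then have fin: "finite ?S" using finite_subset by blast
  have summand: "(of_real ((w * m / 2) ^ n * real (\<Prod>k=1..n. 2 * k - 1) / fact n) * pairing n (ucls w x))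
      \<odot>\<^bsub>H0 w m\<^esub> (chi w m [^]\<^bsub>H0 w m\<^esub> n) = hof (t n)" for n
    unfolding int_pow_int [symmetric] h0_of_single [symmetric] pairing_x t_def d_def
    by (rule arg_cong [of _ _ hof]) (simp add: field_simps)
  have "\<phi> (ucls w x) = hof (const (coeff p 0) * 1 + sum t ?S)"
    by (subst phi) (simp_all only: summand h0_of_finsum [OF fin] uq_counit_cls h0_of_1 h0_of_scale h0_of_add
        presented_algebra_simps(1) rangeI p_def)
  also have "const (coeff p 0) * 1 + sum t ?S = sum t (insert 0 ?S)"
    using fin by (simp add: t_def d_def const_def)
  also have "\<dots> = sum t {..degree p}"
    using S_sub by (intro sum.mono_neutral_left) (auto simp: pairing_x t_def)
  also have "\<dots> = poly_op twist p 1"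
    by (simp add: poly_op_expand [OF linear_op_twist] twist_power t_def d_def)
      (simp add: const_def mult_single)
  finally show ?thesis by (simp add: p_def)
qed

lemma weight: "is_weight w m act \<phi>"
  unfolding is_weight_def
proof (intro conjI ballI allI impI)
  show "clinear (Uq w) (H0 w m) \<phi>"
    unfolding clinear_def
  proof (intro conjI ballI allI)
    show "\<phi> \<in> carrier (Uq w) \<rightarrow> carrier (H0 w m)"
      using h0_of_closed by (auto simp: phi_cls simp del: presented_algebra_simps(1)) (auto simp: phi_cls)
  qed (auto simp: phi_cls h0_of_add h0_of_scale symbol_simps poly_op_add poly_op_smult linear_op_twist)
  show "\<phi> \<one>\<^bsub>Uq w\<^esub> = \<one>\<^bsub>H0 w m\<^esub>"
    by (simp add: phi_cls poly_op_1 linear_op_twist flip: h0_of_1 [simplified])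
next
  fix X Y n P Q
  assume "X \<in> carrier (Uq w)" "Y \<in> carrier (Uq w)" and sw: "sweedler w X n P Q"
  then obtain x y where X: "X = ucls w x" and Y: "Y = ucls w y" by auto
  interpret H: ring "H0 w m" by (rule ring_presented_algebra)
  obtain p q where pq: "\<And>i. i < n \<Longrightarrow> P i = ucls w (p i)" "\<And>i. i < n \<Longrightarrow> Q i = ucls w (q i)"
    and sum: "\<And>a b. (\<Sum>i<n. poly_op (deriv \<kappa>) (symbol (p i)) a * poly_op twist (symbol (q i)) b) =
      poly_op twist (symbol x) (a * b)"
    using sweedler_sum [OF linear_op_deriv linear_op_twist linear_op_twist twist_mult sw [unfolded X]] by blast
  \<comment> \<open>The Sweedler identity is used with \<open>a = ?y\<close>, which is \<phi>[Y],
    and \<open>b = 1\<close>.\<close>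
  let ?y = "poly_op twist (symbol y) 1"
  have "(\<Oplus>\<^bsub>H0 w m\<^esub>i\<in>{..<n}. act (P i) (\<phi> Y) \<otimes>\<^bsub>H0 w m\<^esub> \<phi> (Q i)) =
      (\<Oplus>\<^bsub>H0 w m\<^esub>i\<in>{..<n}. hof (poly_op (deriv \<kappa>) (symbol (p i)) ?y * poly_op twist (symbol (q i)) 1))"
    by (rule H.finsum_cong') (use h0_of_closed in \<open>auto simp: pq Y phi_cls act_hof h0_of_mult\<close>)
  also have "\<dots> = hof (poly_op twist (symbol x) ?y)"
    by (simp add: h0_of_finsum sum)
  also have "\<dots> = \<phi> (X \<otimes>\<^bsub>Uq w\<^esub> Y)"
    by (simp add: X Y phi_cls symbol_mult poly_op_mult linear_op_twist)
  finally show "\<phi> (X \<otimes>\<^bsub>Uq w\<^esub> Y) = (\<Oplus>\<^bsub>H0 w m\<^esub>i\<in>{..<n}. act (P i) (\<phi> Y) \<otimes>\<^bsub>H0 w m\<^esub> \<phi> (Q i))" ..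
qed

subsection \<open>Quasi-invariance\<close>

text \<open>\<kappa> is purely imaginary, so conjugation reverses the sign of both terms.\<close>

lemma map_cnj_twist: "Poly_Mapping.map cnj (twist f) = - twist (Poly_Mapping.map cnj f)"
  by (simp add: twist_def map_cnj_add map_cnj_mult map_cnj_deriv cnj_kappa deriv_uminus single_uminus)

text \<open>The order reversal is invisible to commutative symbols, and carrying the conjugation
  past each \<open>twist\<close> costs a sign. At \<open>f = 1\<close> this computes the factor
  \<phi>[X^*]^* of quasi-invariance.\<close>

lemma star_twist:
  "Poly_Mapping.map cnj (poly_op twist (symbol (free_antihom (\<lambda>c. const (cnj c)) gen x)) f) =
   poly_op (\<lambda>f. - twist f) (symbol x) (Poly_Mapping.map cnj f)"
proof -
  interpret scalar_map "\<lambda>c. const (cnj c) :: galilei_free" by (rule scalar_map_const_cnj)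
  note E = linear_op_twist and F = linear_op_minus_twist
  show ?thesis
  proof (induct x rule: free_algebra_induct)
    case (gen g x)
    let ?s = "symbol (free_antihom (\<lambda>c. const (cnj c)) gen x)"
    have "?s * [:0, 1:] = pCons 0 ?s" "[:0, 1:] * symbol x = pCons 0 (symbol x)" by simp_all
    with gen show ?case
      by (cases g) (simp_all add: free_antihom_mult symbol_mult poly_op_pCons E F map_cnj_twist del: mult_pCons_right mult_pCons_left)
  next
    case (scale c x)
    then show ?case
      by (simp add: free_antihom_mult symbol_mult poly_op_smult E F map_cnj_mult mult.commute [of _ "[:_:]"])
  qed (simp_all add: free_antihom_simps symbol_simps poly_op_1 poly_op_add E F map_cnj_add)
qed

text \<open>The antipode sends the symbol z of B to -z, because M has symbol 0.\<close>

lemma antipode_twist: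
  "poly_op twist (symbol (free_antihom const (antipode_gen w) x)) f = poly_op (\<lambda>f. - twist f) (symbol x) f"
proof -
  interpret scalar_map "const :: complex \<Rightarrow> galilei_free" by (rule scalar_map_const)
  note E = linear_op_twist and F = linear_op_minus_twist
  show ?thesis
  proof (induct x rule: free_algebra_induct)
    case (gen g x)
    let ?s = "symbol (free_antihom const (antipode_gen w) x)"
    have s: "?s * - [:0, 1:] = smult (- 1) (pCons 0 ?s)" "[:0, 1:] * symbol x = pCons 0 (symbol x)" by simp_all
    show ?case
    proof (cases g)
      case Gen_B
      have "symbol (free_antihom const (antipode_gen w) (gen g * x)) = smult (- 1) (pCons 0 ?s)"
        by (simp add: Gen_B free_antihom_mult symbol_simps)
      with gen show ?thesis
        by (simp only: poly_op_smult [OF E]) (simp add: Gen_B symbol_mult poly_op_pCons E F const_uminus)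
    qed (use gen in \<open>simp_all add: free_antihom_mult symbol_simps\<close>)
  next
    case (scale c x)
    then show ?case
      by (simp add: free_antihom_mult symbol_mult poly_op_smult E F mult.commute [of _ "[:_:]"])
  qed (simp_all add: free_antihom_simps symbol_simps poly_op_1 poly_op_add E F)
qed

text \<open>Integration by parts: for h = a b the coefficient of \<chi>^0 in D h is -\<kappa> times
  that of \<chi>^-1 in h, and \<kappa> \<chi> h compensates it exactly.\<close>

lemma deriv_transpose:
  "Poly_Mapping.lookup (poly_op (deriv \<kappa>) p f * g) 0 = Poly_Mapping.lookup (f * poly_op coderiv p g) 0"
proof (induct p arbitrary: g)
  case (pCons c p)
  have parts: "Poly_Mapping.lookup (deriv \<kappa> a * b) 0 = Poly_Mapping.lookup (a * coderiv b) 0" for a b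
  proof -
    have "a * coderiv b = deriv \<kappa> a * b - (deriv \<kappa> (a * b) + a * b * Poly_Mapping.single 1 \<kappa>)"
      by (simp add: coderiv_def deriv_mult algebra_simps)
    moreover have "Poly_Mapping.lookup (deriv \<kappa> (a * b) + a * b * Poly_Mapping.single 1 \<kappa>) 0 = 0"
      by (simp only: lookup_add lookup_deriv lookup_mult_single) simp
    ultimately show ?thesis by (simp only: lookup_minus) simp
  qed
  have "Poly_Mapping.lookup (poly_op (deriv \<kappa>) (pCons c p) f * g) 0 =
      Poly_Mapping.lookup (const c * (f * g)) 0 + Poly_Mapping.lookup (deriv \<kappa> (poly_op (deriv \<kappa>) p f) * g) 0"
    by (simp add: poly_op_pCons linear_op_deriv distrib_right lookup_add mult.assoc)
  also have "Poly_Mapping.lookup (deriv \<kappa> (poly_op (deriv \<kappa>) p f) * g) 0 =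
      Poly_Mapping.lookup (f * coderiv (poly_op coderiv p g)) 0"
    by (simp add: parts pCons poly_op_commute linear_op_coderiv)
  finally show ?case
    by (simp add: poly_op_pCons linear_op_coderiv distrib_left lookup_add mult_ac)
qed simp

text \<open>Transposition moves the action of X from \<open>a\<close> to 1 as a polynomial in
  \<open>coderiv\<close>. The Sweedler identity, taken at 1 and 1, splits this into the star and
  antipode factors of the weight.\<close>

lemma quasi_invariant_nu: "quasi_invariant w m act \<nu> \<phi>"
  unfolding quasi_invariant_def
proof (intro conjI ballI allI impI)
  show "real_functional w m \<nu>"
    unfolding real_functional_def using nu_linear
    by (auto simp: carrier_hof nu_hof h0_star_h0_of simp del: presented_algebra_simps(1))
  show "is_weight w m act \<phi>" by (rule weight)
next
  fix X a n P Q
  assume "X \<in> carrier (Uq w)" "a \<in> carrier (H0 w m)" and sw: "sweedler w X n P Q"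
  then obtain x f where X: "X = ucls w x" and a: "a = hof f" using carrier_hof by auto
  let ?E = "\<lambda>f. - twist f"
  obtain p q where pq: "\<And>i. i < n \<Longrightarrow> P i = ucls w (p i)" "\<And>i. i < n \<Longrightarrow> Q i = ucls w (q i)"
    and sum: "\<And>a b. (\<Sum>i<n. poly_op ?E (symbol (p i)) a * poly_op ?E (symbol (q i)) b) =
      poly_op coderiv (symbol x) (a * b)"
    using sweedler_sum [OF linear_op_minus_twist linear_op_minus_twist linear_op_coderiv coderiv_mult sw [unfolded X]]
    by blast
  have "\<nu> (act X a) = Poly_Mapping.lookup (f * poly_op coderiv (symbol x) 1) 0"
    using deriv_transpose [of "symbol x" f 1] by (simp add: X a act_hof nu_hof)
  also have "\<dots> = (\<Sum>i<n. Poly_Mapping.lookup (f * (poly_op ?E (symbol (p i)) 1 * poly_op ?E (symbol (q i)) 1)) 0)"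
    using sum [of 1 1] by (simp flip: sum_distrib_left lookup_sum)
  also have "\<dots> = (\<Sum>i<n. \<nu> (h0_star w m (\<phi> (uq_star w (P i))) \<otimes>\<^bsub>H0 w m\<^esub> a \<otimes>\<^bsub>H0 w m\<^esub> \<phi> (uq_antipode w (Q i))))"
    by (intro sum.cong refl)
      (simp add: pq a uq_star_cls uq_antipode_cls phi_cls h0_star_h0_of star_twist antipode_twist
        h0_of_mult nu_hof mult_ac)
  finally show "\<nu> (act X a) =
      (\<Sum>i<n. \<nu> (h0_star w m (\<phi> (uq_star w (P i))) \<otimes>\<^bsub>H0 w m\<^esub> a \<otimes>\<^bsub>H0 w m\<^esub> \<phi> (uq_antipode w (Q i))))" .
qed

subsection \<open>Failure of essential invariance\<close>

lemma not_essentially_invariant: "\<not> essentially_invariant w m act \<nu>"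
proof
  assume "essentially_invariant w m act \<nu>"
  then obtain \<xi> where xi: "\<xi> \<in> Units (H0 w m)"
    and qi: "quasi_invariant w m act \<nu> (\<lambda>X. act X \<xi> \<otimes>\<^bsub>H0 w m\<^esub> inv\<^bsub>H0 w m\<^esub> \<xi>)"
    by (auto simp: essentially_invariant_def)
  interpret H: ring "H0 w m" by (rule ring_presented_algebra)
  obtain f where f: "\<xi> = hof f"
    using H.Units_closed [OF xi] carrier_hof by auto
  obtain g where g: "inv\<^bsub>H0 w m\<^esub> \<xi> = hof g"
    using H.Units_inv_closed [OF xi] carrier_hof by auto
  have "hof (f * g) = hof 1"
    using H.Units_r_inv [OF xi] by (simp only: f g [unfolded f] h0_of_mult h0_of_1)
  \<comment> \<open>Injectivity moves invertibility from H0 to Laurent polynomials, where degrees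
    are available.\<close>
  then have fg: "f * g = 1"
    using inj_h0_of [OF nu_linear nu_chi] by (simp add: inj_eq)
  define \<rho> where "\<rho> = deriv \<kappa> f * g"
  obtain k :: int where k: "Poly_Mapping.lookup \<rho> 1 = \<kappa> * of_int k"
    using lookup_log_deriv [OF fg] unfolding \<rho>_def by blast
  interpret A: scalar_map "const :: complex \<Rightarrow> galilei_free" by (rule scalar_map_const)
  interpret C: scalar_map "\<lambda>c. const (cnj c) :: galilei_free" by (rule scalar_map_const_cnj)
  have weight_B: "act (ucls w (gen Gen_B)) \<xi> \<otimes>\<^bsub>H0 w m\<^esub> inv\<^bsub>H0 w m\<^esub> \<xi> = hof \<rho>"
    by (simp add: f g [unfolded f] act_B h0_of_mult \<rho>_def)
  have weight_Kinv: "act (ucls w (gen Gen_Kinv)) \<xi> \<otimes>\<^bsub>H0 w m\<^esub> inv\<^bsub>H0 w m\<^esub> \<xi> = hof 1"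
    by (simp add: f g [unfolded f] act_hof poly_op_1 linear_op_deriv h0_of_mult fg)
  have weight_SB: "act (ucls w (antipode_gen w Gen_B)) \<xi> \<otimes>\<^bsub>H0 w m\<^esub> inv\<^bsub>H0 w m\<^esub> \<xi> = hof (- \<rho>)"
    by (simp add: f g [unfolded f] act_hof symbol_simps poly_op_pCons linear_op_deriv linear_op_0
        const_uminus deriv_minus h0_of_mult \<rho>_def)
  \<comment> \<open>With \<chi>^-1 in the middle, \<nu> reads off the coefficients of \<chi> in the
    weights.\<close>
  let ?a = "Poly_Mapping.single (-1) 1 :: laurent"
  have "\<nu> (act (uq_B w) (hof ?a)) =
      (\<Sum>i<2::nat. \<nu> (h0_star w m (act (uq_star w (if i = 0 then ucls w (gen Gen_B) else ucls w (gen Gen_Kinv))) \<xi>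
        \<otimes>\<^bsub>H0 w m\<^esub> inv\<^bsub>H0 w m\<^esub> \<xi>) \<otimes>\<^bsub>H0 w m\<^esub> hof ?a
        \<otimes>\<^bsub>H0 w m\<^esub> (act (uq_antipode w (if i = 0 then ucls w (gen Gen_K) else ucls w (gen Gen_B))) \<xi>
          \<otimes>\<^bsub>H0 w m\<^esub> inv\<^bsub>H0 w m\<^esub> \<xi>)))"
    by (rule qi [unfolded quasi_invariant_def, THEN conjunct2, THEN conjunct2, rule_format, OF _ _ sweedler_B])
      (simp_all add: uq_B_def)
  also have "\<dots> = Poly_Mapping.lookup (Poly_Mapping.map cnj \<rho> * ?a) 0 + Poly_Mapping.lookup (?a * - \<rho>) 0"
    by (simp add: eval_nat_numeral uq_star_cls uq_antipode_cls weight_B weight_Kinv weight_SB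
        h0_star_h0_of h0_of_mult nu_hof del: antipode_gen.simps(3))
  \<comment> \<open>As \<kappa> is imaginary, the conjugated coefficient is -\<kappa> k, so both
    terms contribute equally.\<close>
  also have "\<dots> = - 2 * \<kappa> * of_int k"
    by (simp add: mult.commute [of ?a] lookup_mult_single k cnj_kappa)
  finally have "- \<kappa> = - 2 * \<kappa> * of_int k"
    by (simp add: uq_B_def act_B nu_hof deriv_single)
  \<comment> \<open>Cancelling \<kappa> leaves 2k = 1. The half-integer exponent of the formal \<xi>
    is what an invertible Laurent polynomial cannot supply.\<close>
  then have "\<kappa> * (of_int (2 * k) - of_int 1) = 0"
    by (simp add: algebra_simps)
  then have "of_int (2 * k) = (of_int 1 :: complex)"
    using kappa_nonzero by simp
  then have "2 * k = 1" by (simp only: of_int_eq_iff)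
  then show False by presburger
qed

end

theorem proposition5p1:
  fixes w m :: real
    and act :: "galilei_free set \<Rightarrow> h0_free set \<Rightarrow> h0_free set"
    and \<nu> :: "h0_free set \<Rightarrow> complex"
    and pairing :: "nat \<Rightarrow> galilei_free set \<Rightarrow> complex"
    and \<phi> :: "galilei_free set \<Rightarrow> h0_free set"
  assumes "w \<noteq> 0" and "m \<noteq> 0"
    and "module_star_algebra w m act"
    and "\<And>l::int. act (uq_B w) (chi w m [^]\<^bsub>H0 w m\<^esub> l) =
           (\<i> * of_real (w * m) * of_int l) \<odot>\<^bsub>H0 w m\<^esub> (chi w m [^]\<^bsub>H0 w m\<^esub> (l + 1))"
    and "\<And>f. f \<in> carrier (H0 w m) \<Longrightarrow> act (uq_K w) f = f"
    and "\<And>f. f \<in> carrier (H0 w m) \<Longrightarrow> act (uq_T w) f = \<zero>\<^bsub>H0 w m\<^esub>"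
    and "\<And>f. f \<in> carrier (H0 w m) \<Longrightarrow> act (uq_M w) f = \<zero>\<^bsub>H0 w m\<^esub>"
    and "linear_functional (H0 w m) \<nu>"
    and "\<And>l::int. \<nu> (chi w m [^]\<^bsub>H0 w m\<^esub> l) = (if l = 0 then 1 else 0)"
    and "is_v_pairing w pairing"
    and "\<And>X. X \<in> carrier (Uq w) \<Longrightarrow>
           \<phi> X = uq_counit X \<odot>\<^bsub>H0 w m\<^esub> \<one>\<^bsub>H0 w m\<^esub> \<oplus>\<^bsub>H0 w m\<^esub>
             (\<Oplus>\<^bsub>H0 w m\<^esub>n\<in>{n. n \<ge> 1 \<and> pairing n X \<noteq> 0}.
                (of_real ((w * m / 2) ^ n * real (\<Prod>k=1..n. 2 * k - 1) / fact n) * pairing n X)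
                \<odot>\<^bsub>H0 w m\<^esub> (chi w m [^]\<^bsub>H0 w m\<^esub> n))"
  shows "quasi_invariant w m act \<nu> \<phi> \<and> \<not> essentially_invariant w m act \<nu>"
proof -
  interpret galilei_h0_action w m act \<nu> pairing \<phi>
    by standard (fact assms)+
  show ?thesis using quasi_invariant_nu not_essentially_invariant by simp
qed

end
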